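(* Let $(T,d,\rho)$ be a Polish $\mathbb{R}$-tree. Then the family of mass erasure operators $(\mathscr{E}_h)_{h\ge 0}$ forms a semigroup on $\mathscr{M}_{\rm di}(T)$, i.e. $\mathscr{E}_h\circ\mathscr{E}_{h'}=\mathscr{E}_{h+h'}$ for all $h,h'\ge 0$.
   Context: An $\mathbb{R}$-tree is a pointed metric space $(T,d,\rho)$ (root $\rho$) such that any $\sigma_1,\sigma_2\in T$ are the end points of a unique segment $[\sigma_1,\sigma_2]$ (isometric image of a compact real interval), and whenever two segments satisfy $[\sigma_1,\sigma_0]\cap[\sigma_0,\sigma_2]=\{\sigma_0\}$, their union is a segment with end points $\sigma_1,\sigma_2$. It is called Polish if $(T,d)$ is complete and separable. Set $\theta_\sigma T=\{\sigma'\in T:\sigma\in[\rho,\sigma']\}$. For $r>0$, $\overline B_T(\rho,r)=\{\sigma: d(\rho,\sigma)\le r\}$ and $\partial B_T(\rho,r)=\{\sigma:d(\rho,\sigma)=r\}$. The degree $n(\sigma,T)\in\mathbb{N}_0\cup\{+\infty\}$ is the number of connected components of $T\setminus\{\sigma\}$; ${\rm Lf}(T)=\{\sigma\ne\rho:n(\sigma,T)=1\}$ and ${\rm Bp}(T)=\{\sigma\ne\rho: n(\sigma,T)\ge 3\}$. An $\mathbb{R}$-tree $T$ is discrete if it is complete and $n(\rho,T)+\sum_{\sigma\in{\rm Bp}(T)\cap\overline B_T(\rho,r)}n(\sigma,T)<\infty$ for all $r>0$. A Borel measure is boundedly finite if it is finite on bounded Borel sets; $\mathscr{M}_{\rm bf}(T)$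 is the set of these and $\mathscr{M}_{\rm fin}(T)$ the set of finite Borel measures. Let ${\rm Skel}(T,\mu)=\{\rho\}\cup\{\sigma\in T:\mu(\theta_\sigma T)=+\infty\}$ and $F_\mu(T)=T\setminus{\rm Skel}(T,\mu)$. $\mu\in\mathscr{M}_{\rm bf}(T)$ is discretely infinite if $\mu(T)=+\infty$, ${\rm Skel}(T,\mu)$ is a discrete $\mathbb{R}$-tree, and $\mu\big(\bigcup_{\sigma\in\partial B_T(\rho,r)\cap F_\mu(T)}\theta_\sigma T\big)<\infty$ for all $r>0$. $\mathscr{M}_{\rm di}(T)$ is the set of all finite or discretely infinite measures on $T$. For a closed rooted subtree $T'\subseteq T$ (closed, connected, containing $\rho$), $f_{T'}(\sigma)$ is the unique point with $[\rho,\sigma]\cap T'=[\rho,f_{T'}(\sigma)]$, and ${\rm Pr}_{T'}\mu=\mu\circ f_{T'}^{-1}$ (regarded as a measure on $T$). Set $R_{\mu,h}(T)=\{\rho\}\cup\{\sigma:\mu(\theta_\sigma T)\ge h\}$. Mass erasure: $\mathscr{E}_0\mu=\mu$, and for $h>0$, $\mu\in\mathscr{M}_{\rm di}(T)$, writing $R=R_{\mu,h}(T)$: if $\mu(T)<h$ then $\mathscr{E}_h\mu=0$; otherwise $$\mathscr{E}_h\mu={\rm Pr}_R\mu(\,\cdot\cap(R\setminus{\rm Lf}(R)))+\sum_{\sigma\in{\rm Lf}(R)}(\mu(\theta_\sigma T)-h)\delta_\sigma+h(n(\rho,R)-1)\delta_\rho+h\sum_{\sigma\in{\rm Bp}(R)}(n(\sigma,R)-2)\delta_\sigma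 .$$ This defines an operator $\mathscr{E}_h:\mathscr{M}_{\rm di}(T)\to\mathscr{M}_{\rm di}(T)$. *)

theory Defs
  imports "HOL-Analysis.Analysis"
begin

text \<open>
  The ambient Polish tree is a whole type of class \<open>polish_space\<close> (a complete separable metric
  space), so that measures on it are Borel measures of type \<open>'a measure\<close>. Subtrees are subsets of
  the type with the induced metric and the same root \<open>\<rho>\<close>; notions that are also needed for
  subtrees take the carrier set \<open>S\<close> as an argument.
\<close>

section \<open>Real trees\<close>

definition is_segment :: "'a::metric_space set \<Rightarrow> 'a \<Rightarrow> 'a \<Rightarrow> bool" where
  "is_segment I x y \<longleftrightarrow>
     (\<exists>(a::real) b \<gamma>. a \<le> b \<and> (\<forall>s\<in>{a..b}. \<forall>t\<in>{a..b}. dist (\<gamma> s) (\<gamma> t) = \<bar>s - t\<bar>) \<and>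
        \<gamma> ` {a..b} = I \<and> \<gamma> a = x \<and> \<gamma> b = y)"

definition real_tree :: "'a::metric_space set \<Rightarrow> 'a \<Rightarrow> bool" where
  "real_tree S \<rho> \<longleftrightarrow> \<rho> \<in> S \<and>
     (\<forall>x\<in>S. \<forall>y\<in>S. \<exists>!I. I \<subseteq> S \<and> is_segment I x y) \<and>
     (\<forall>x\<in>S. \<forall>y\<in>S. \<forall>z\<in>S. \<forall>I J. I \<subseteq> S \<longrightarrow> J \<subseteq> S \<longrightarrow> is_segment I x z \<longrightarrow> is_segment J z y \<longrightarrow>
        I \<inter> J = {z} \<longrightarrow> is_segment (I \<union> J) x y)"

definition seg :: "'a::metric_space \<Rightarrow> 'a \<Rightarrow> 'a set" where
  "seg x y = (THE I. is_segment I x y)"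

definition subtree_above :: "'a::metric_space \<Rightarrow> 'a \<Rightarrow> 'a set" where
  "subtree_above \<rho> \<sigma> = {\<sigma>'. \<sigma> \<in> seg \<rho> \<sigma>'}"

definition degree :: "'a::metric_space \<Rightarrow> 'a set \<Rightarrow> enat" where
  "degree \<sigma> S =
     (if finite (components (S - {\<sigma>})) then enat (card (components (S - {\<sigma>}))) else \<infinity>)"

definition leaves :: "'a::metric_space \<Rightarrow> 'a set \<Rightarrow> 'a set" where
  "leaves \<rho> S = {\<sigma>\<in>S. \<sigma> \<noteq> \<rho> \<and> degree \<sigma> S = 1}"

definition branch_points :: "'a::metric_space \<Rightarrow> 'a set \<Rightarrow> 'a set" where
  "branch_points \<rho> S = {\<sigma>\<in>S. \<sigma> \<noteq> \<rho> \<and> degree \<sigma> S \<ge> 3}"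

definition discrete_real_tree :: "'a::metric_space set \<Rightarrow> 'a \<Rightarrow> bool" where
  "discrete_real_tree S \<rho> \<longleftrightarrow> real_tree S \<rho> \<and> complete S \<and>
     (\<forall>r>0. ennreal_of_enat (degree \<rho> S) +
        (\<Sum>\<^sub>\<infinity>\<sigma>\<in>branch_points \<rho> S \<inter> cball \<rho> r. ennreal_of_enat (degree \<sigma> S)) < \<infinity>)"

definition tree_proj :: "'a::metric_space \<Rightarrow> 'a set \<Rightarrow> 'a \<Rightarrow> 'a" where
  "tree_proj \<rho> S \<sigma> = (THE \<tau>. seg \<rho> \<sigma> \<inter> S = seg \<rho> \<tau>)"


section \<open>Finite and discretely infinite measures\<close>

definition finite_borel_measures :: "'a::metric_space measure set" where
  "finite_borel_measures = {\<mu>. sets \<mu> = sets borel \<and> emeasure \<mu> UNIV < \<infinity>}"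

definition boundedly_finite_measures :: "'a::metric_space measure set" where
  "boundedly_finite_measures =
     {\<mu>. sets \<mu> = sets borel \<and> (\<forall>A\<in>sets borel. bounded A \<longrightarrow> emeasure \<mu> A < \<infinity>)}"

definition Skel :: "'a::metric_space \<Rightarrow> 'a measure \<Rightarrow> 'a set" where
  "Skel \<rho> \<mu> = {\<rho>} \<union> {\<sigma>. emeasure \<mu> (subtree_above \<rho> \<sigma>) = \<infinity>}"

text \<open>
  Once the skeleton is a discrete tree, it is closed, and the union in the last condition is a
  Borel set. Hence the convention that \<open>emeasure\<close> vanishes off the \<open>\<sigma>\<close>-algebra is not
  used.
\<close>

definition discretely_infinite :: "'a::metric_space \<Rightarrow> 'a measure \<Rightarrow> bool" where
  "discretely_infinite \<rho> \<mu> \<longleftrightarrow> emeasure \<mu> UNIV = \<infinity> \<and> discrete_real_tree (Skel \<rho> \<mu>) \<rho> \<and>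
     (\<forall>r>0. emeasure \<mu> (\<Union>\<sigma>\<in>sphere \<rho> r \<inter> - Skel \<rho> \<mu>. subtree_above \<rho> \<sigma>) < \<infinity>)"

definition di_measures :: "'a::metric_space \<Rightarrow> 'a measure set" where
  "di_measures \<rho> =
     finite_borel_measures \<union> {\<mu>\<in>boundedly_finite_measures. discretely_infinite \<rho> \<mu>}"


section \<open>Mass erasure\<close>

definition mass_level_set :: "'a::metric_space \<Rightarrow> 'a measure \<Rightarrow> real \<Rightarrow> 'a set" where
  "mass_level_set \<rho> \<mu> h = {\<rho>} \<union> {\<sigma>. emeasure \<mu> (subtree_above \<rho> \<sigma>) \<ge> ennreal h}"

definition Pr :: "'a::metric_space \<Rightarrow> 'a set \<Rightarrow> 'a measure \<Rightarrow> 'a measure" where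
  "Pr \<rho> S \<mu> = distr \<mu> borel (tree_proj \<rho> S)"

text \<open>
  The coefficient \<open>h (n(\<rho>, R) - 1)\<close> of the point mass at the root equals \<open>- h\<close> if
  \<open>R = {\<rho>}\<close>. As subtraction on \<open>ennreal\<close> truncates at \<open>0\<close>, the term \<open>- h \<delta>\<^sub>\<rho>\<close> is
  subtracted from the total. It is dominated there: \<open>R = {\<rho>}\<close> projects the whole mass
  \<open>\<mu>(T) \<ge> h\<close> to \<open>\<rho>\<close>, and otherwise \<open>n(\<rho>, R) \<ge> 1\<close>. The other subtractions do not
  truncate, by the definitions of \<open>R\<close> and of branch points.
\<close>

definition mass_erasure :: "'a::metric_space \<Rightarrow> real \<Rightarrow> 'a measure \<Rightarrow> 'a measure" where
  "mass_erasure \<rho> h \<mu> =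
     (if h = 0 then \<mu>
      else if emeasure \<mu> UNIV < ennreal h then null_measure borel
      else let R = mass_level_set \<rho> \<mu> h in
        measure_of UNIV (sets borel) (\<lambda>A.
            emeasure (Pr \<rho> R \<mu>) (A \<inter> (R - leaves \<rho> R))
          + (\<Sum>\<^sub>\<infinity>\<sigma>\<in>leaves \<rho> R. (emeasure \<mu> (subtree_above \<rho> \<sigma>) - ennreal h) * indicator A \<sigma>)
          + ennreal h * ennreal_of_enat (degree \<rho> R) * indicator A \<rho>
          + ennreal h *
              (\<Sum>\<^sub>\<infinity>\<sigma>\<in>branch_points \<rho> R. (ennreal_of_enat (degree \<sigma> R) - 2) * indicator A \<sigma>)
          - ennreal h * indicator A \<rho>))"

end

theory Submission
  imports Defs
begin

text \<open>
  Write \<open>m \<sigma>\<close> for the mass of the subtree above \<open>\<sigma>\<close>. In a finite tree the number of leaves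
  exceeds the total branching excess by one, so erasure at level \<open>h\<close> turns \<open>m \<sigma>\<close> into the
  truncated difference \<open>m \<sigma> - h\<close>. The sets of points above some \<open>\<sigma>\<close> form a \<open>\<pi>\<close>-system
  generating the Borel sets, which settles the case of finite measures. For infinite measures
  \<open>m\<close> does not see the mass on the skeleton. There one cuts the tree at the \<open>k\<close> skeleton points
  above \<open>\<sigma>\<close> at height \<open>r\<close>; what remains above \<open>\<sigma>\<close> has finite mass, and erasure adds
  \<open>h (k - 1)\<close> to it. Both formulas are additive in \<open>h\<close>.
\<close>

section \<open>The order of a rooted real tree\<close>

text \<open>Subtracting h from an infinite mass leaves it infinite, so erasure keeps the cut points
  at every height. The number k is therefore the same before and after an erasure, and the cut
  formula can be iterated on one fixed family of sets. In \<open>ennreal\<close> it reads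
  \<open>a + h * k - h\<close>, where a is the mass left above \<sigma>; truncation can occur only
  for k = 0. The obstacle to counting is that a level set may have infinitely many leaves, and
  skeleton rays that end in no leaf at all. After the cut, the up-sets of the leaves that remain are
  disjoint, have mass at least h each, and lie in a set of finite mass, so these leaves are finite
  in number. Together with the cut points they form a finite antichain that branches exactly as the
  level set does inside the cut. For the semigroup law, finiteness and discreteness enter only
  through the predicate \<open>tame\<close>, which both kinds of measure satisfy and which erasure
  preserves.\<close>

lemma is_segmentI:
  assumes "a \<le> b" "\<And>s t. s \<in> {a..b} \<Longrightarrow> t \<in> {a..b} \<Longrightarrow> dist (\<gamma> s) (\<gamma> t) = \<bar>s - t\<bar>"
    "\<gamma> ` {a..b} = I" "\<gamma> a = x" "\<gamma> b = y"
  shows "is_segment I x y"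
  unfolding is_segment_def using assms by blast

lemma is_segment_normalized:
  assumes "is_segment I x y"
  obtains \<gamma> where "\<And>s t. s \<in> {0..dist x y} \<Longrightarrow> t \<in> {0..dist x y} \<Longrightarrow> dist (\<gamma> s) (\<gamma> t) = \<bar>s - t\<bar>"
    "\<gamma> ` {0..dist x y} = I" "\<gamma> 0 = x" "\<gamma> (dist x y) = y"
proof -
  obtain a b \<gamma> where g: "a \<le> b" "\<And>s t. s \<in> {a..b} \<Longrightarrow> t \<in> {a..b} \<Longrightarrow> dist (\<gamma> s) (\<gamma> t) = \<bar>s - t\<bar>"
    "\<gamma> ` {a..b} = I" "\<gamma> a = x" "\<gamma> b = y"
    using assms unfolding is_segment_def by blast
  have d: "dist x y = b - a"
    using g(2)[of a b] g(1,4,5) by auto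
  have im: "(\<lambda>t. t + a) ` {0..b - a} = {a..b}"
    by (simp add: image_add_atLeastAtMost' add.commute)
  show thesis
  proof (rule that[of "\<lambda>t. \<gamma> (t + a)"])
    show "(\<lambda>t. \<gamma> (t + a)) ` {0..dist x y} = I"
      using im g(3) unfolding d by (metis image_image)
  qed (use g d in auto)
qed

lemma dist_segment:
  assumes "is_segment I x y" "z \<in> I"
  shows "dist x y = dist x z + dist z y"
proof -
  obtain a b \<gamma> where g: "a \<le> b" "\<And>s t. s \<in> {a..b} \<Longrightarrow> t \<in> {a..b} \<Longrightarrow> dist (\<gamma> s) (\<gamma> t) = \<bar>s - t\<bar>"
    "\<gamma> ` {a..b} = I" "\<gamma> a = x" "\<gamma> b = y"
    using assms(1) unfolding is_segment_def by blast
  obtain c where "c \<in> {a..b}" "z = \<gamma> c" using g assms by auto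
  then show ?thesis using g(2)[of a b] g(2)[of a c] g(2)[of c b] g(1,4,5) by auto
qed

locale rooted_real_tree =
  fixes \<rho> :: "'a::polish_space"
  assumes real_tree: "real_tree (UNIV :: 'a set) \<rho>"
begin

lemma real_treeD:
  "\<forall>x y :: 'a. \<exists>!I. is_segment I x y"
  "\<forall>(x :: 'a) y z I. is_segment I x z \<longrightarrow>
     (\<forall>J. is_segment J z y \<longrightarrow> I \<inter> J = {z} \<longrightarrow> is_segment (I \<union> J) x y)"
  using real_tree unfolding real_tree_def by simp_all

lemma ex1_is_segment: "\<exists>!I. is_segment I (x :: 'a) y"
  by (rule spec[OF spec[OF real_treeD(1)]])

lemma is_segment_unique: "is_segment I (x :: 'a) y \<Longrightarrow> is_segment J x y \<Longrightarrow> I = J"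
  using ex1_is_segment[of x y] by (metis (full_types))

lemma is_segment_seg: "is_segment (seg x y) (x :: 'a) y"
  unfolding seg_def by (rule theI') (rule ex1_is_segment)

lemma seg_eqI: "is_segment I (x :: 'a) y \<Longrightarrow> seg x y = I"
  using is_segment_unique is_segment_seg by blast

lemma is_segment_glue:
  "is_segment I (x :: 'a) z \<Longrightarrow> is_segment J z y \<Longrightarrow> I \<inter> J = {z} \<Longrightarrow> is_segment (I \<union> J) x y"
  using real_treeD(2) by simp

section \<open>Heights and parametrised segments from the root\<close>

abbreviation ht :: "'a \<Rightarrow> real" where "ht x \<equiv> dist \<rho> x"

text \<open>Only the values on \<open>{0..ht y}\<close> are specified, so facts about
  \<open>pt\<close> carry range hypotheses.\<close>

definition pt :: "'a \<Rightarrow> real \<Rightarrow> 'a" where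
  "pt y = (SOME \<gamma>. (\<forall>s\<in>{0..ht y}. \<forall>t\<in>{0..ht y}. dist (\<gamma> s) (\<gamma> t) = \<bar>s - t\<bar>) \<and>
     \<gamma> ` {0..ht y} = seg \<rho> y \<and> \<gamma> 0 = \<rho> \<and> \<gamma> (ht y) = y)"

lemma pt_props:
  "(\<forall>s\<in>{0..ht y}. \<forall>t\<in>{0..ht y}. dist (pt y s) (pt y t) = \<bar>s - t\<bar>) \<and>
     pt y ` {0..ht y} = seg \<rho> y \<and> pt y 0 = \<rho> \<and> pt y (ht y) = y"
proof -
  obtain \<gamma> where "\<And>s t. s \<in> {0..ht y} \<Longrightarrow> t \<in> {0..ht y} \<Longrightarrow> dist (\<gamma> s) (\<gamma> t) = \<bar>s - t\<bar>"
    "\<gamma> ` {0..ht y} = seg \<rho> y" "\<gamma> 0 = \<rho>" "\<gamma> (ht y) = y"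
    using is_segment_normalized[OF is_segment_seg[of \<rho> y]] by metis
  then have "\<exists>\<gamma>. (\<forall>s\<in>{0..ht y}. \<forall>t\<in>{0..ht y}. dist (\<gamma> s) (\<gamma> t) = \<bar>s - t\<bar>) \<and>
     \<gamma> ` {0..ht y} = seg \<rho> y \<and> \<gamma> 0 = \<rho> \<and> \<gamma> (ht y) = y"
    by (intro exI[of _ \<gamma>]) simp
  from someI_ex[OF this, folded pt_def] show ?thesis .
qed

lemma dist_pt: "0 \<le> s \<Longrightarrow> s \<le> ht y \<Longrightarrow> 0 \<le> t \<Longrightarrow> t \<le> ht y \<Longrightarrow> dist (pt y s) (pt y t) = \<bar>s - t\<bar>"
  using pt_props by auto

lemma pt_0 [simp]: "pt y 0 = \<rho>" and pt_ht [simp]: "pt y (ht y) = y"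
  and seg_eq_pt: "seg \<rho> y = pt y ` {0..ht y}"
  using pt_props by auto

lemma ht_pt: "0 \<le> t \<Longrightarrow> t \<le> ht y \<Longrightarrow> ht (pt y t) = t"
  using dist_pt[of 0 y t] by simp

lemma is_segment_pt:
  assumes "0 \<le> s" "s \<le> t" "t \<le> ht y"
  shows "is_segment (pt y ` {s..t}) (pt y s) (pt y t)"
  by (rule is_segmentI[of s t "pt y"]) (use assms dist_pt in auto)

lemma is_segment_pt_rev:
  assumes "0 \<le> s" "s \<le> t" "t \<le> ht y"
  shows "is_segment (pt y ` {s..t}) (pt y t) (pt y s)"
proof (rule is_segmentI[of "-t" "-s" "\<lambda>r. pt y (- r)"])
  have "uminus ` {-t..-s} = {s..t}" by simp
  then show "(\<lambda>r. pt y (- r)) ` {- t..- s} = pt y ` {s..t}"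
    by (metis image_image)
qed (use assms dist_pt in auto)

text \<open>Uniqueness of segments: the initial piece of the segment to y is the segment to
  \<open>pt y t\<close>, and a point on it is determined by its height.\<close>

lemma pt_pt:
  assumes "0 \<le> s" "s \<le> t" "t \<le> ht y"
  shows "pt (pt y t) s = pt y s"
proof -
  have "seg \<rho> (pt y t) = pt y ` {0..t}"
    by (rule seg_eqI) (use is_segment_pt[of 0 t y] assms in auto)
  moreover have "pt (pt y t) s \<in> seg \<rho> (pt y t)"
    unfolding seg_eq_pt using assms ht_pt by auto
  ultimately obtain r where r: "0 \<le> r" "r \<le> t" "pt (pt y t) s = pt y r" by auto
  then have "r = s"
    using ht_pt[of s "pt y t"] ht_pt[of r y] ht_pt[of t y] assms by auto
  then show ?thesis using r by simp
qed

section \<open>The tree order\<close>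

definition le :: "'a \<Rightarrow> 'a \<Rightarrow> bool"  (infix "\<sqsubseteq>" 50) where
  "x \<sqsubseteq> y \<longleftrightarrow> x \<in> seg \<rho> y"

abbreviation less :: "'a \<Rightarrow> 'a \<Rightarrow> bool"  (infix "\<sqsubset>" 50) where
  "x \<sqsubset> y \<equiv> x \<sqsubseteq> y \<and> x \<noteq> y"

abbreviation up :: "'a \<Rightarrow> 'a set" where
  "up \<equiv> subtree_above \<rho>"

lemma mem_up [simp]: "y \<in> up x \<longleftrightarrow> x \<sqsubseteq> y"
  by (simp add: subtree_above_def le_def)

lemma le_iff: "x \<sqsubseteq> y \<longleftrightarrow> ht x \<le> ht y \<and> pt y (ht x) = x"
proof
  assume "x \<sqsubseteq> y"
  then obtain t where "0 \<le> t" "t \<le> ht y" "x = pt y t"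
    unfolding le_def seg_eq_pt by auto
  then show "ht x \<le> ht y \<and> pt y (ht x) = x" using ht_pt by auto
next
  assume "ht x \<le> ht y \<and> pt y (ht x) = x"
  then show "x \<sqsubseteq> y" unfolding le_def seg_eq_pt
    by (metis atLeastAtMost_iff imageI zero_le_dist)
qed

lemma le_ht: "x \<sqsubseteq> y \<Longrightarrow> ht x \<le> ht y"
  by (simp add: le_iff)

lemma le_refl [simp]: "x \<sqsubseteq> x"
  by (simp add: le_iff)

lemma root_le [simp]: "\<rho> \<sqsubseteq> x"
  by (simp add: le_iff)

lemma le_root: "x \<sqsubseteq> \<rho> \<longleftrightarrow> x = \<rho>"
  by (auto simp: le_iff)

lemma le_eq_ht: "x \<sqsubseteq> y \<Longrightarrow> ht y \<le> ht x \<Longrightarrow> x = y"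
  by (metis le_iff order_antisym pt_ht)

lemma le_antisym: "x \<sqsubseteq> y \<Longrightarrow> y \<sqsubseteq> x \<Longrightarrow> x = y"
  using le_eq_ht le_ht by blast

lemma less_ht: "x \<sqsubset> y \<Longrightarrow> ht x < ht y"
  using le_eq_ht by fastforce

lemma pt_le: "0 \<le> t \<Longrightarrow> t \<le> ht y \<Longrightarrow> pt y t \<sqsubseteq> y"
  by (auto simp: le_def seg_eq_pt)

lemma le_trans: "x \<sqsubseteq> y \<Longrightarrow> y \<sqsubseteq> z \<Longrightarrow> x \<sqsubseteq> z"
  using pt_pt[of "ht x" "ht y" z] unfolding le_iff by auto

lemma pt_eq: "x \<sqsubseteq> y \<Longrightarrow> 0 \<le> t \<Longrightarrow> t \<le> ht x \<Longrightarrow> pt y t = pt x t"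
  by (metis le_iff pt_pt)

lemma le_below_linear: "x \<sqsubseteq> z \<Longrightarrow> y \<sqsubseteq> z \<Longrightarrow> ht x \<le> ht y \<Longrightarrow> x \<sqsubseteq> y"
  by (metis le_iff pt_eq zero_le_dist)

lemma le_below_cases: "x \<sqsubseteq> z \<Longrightarrow> y \<sqsubseteq> z \<Longrightarrow> x \<sqsubseteq> y \<or> y \<sqsubseteq> x"
  using le_below_linear by (meson linear)

lemma pt_mono: "0 \<le> s \<Longrightarrow> s \<le> t \<Longrightarrow> t \<le> ht y \<Longrightarrow> pt y s \<sqsubseteq> pt y t"
  by (metis ht_pt order_trans pt_le pt_pt)

lemma pt_mem_iff_le: "0 \<le> t \<Longrightarrow> t \<le> ht y \<Longrightarrow> x \<sqsubseteq> y \<Longrightarrow> x \<sqsubseteq> pt y t \<longleftrightarrow> ht x \<le> t"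
  by (metis ht_pt le_below_linear le_ht pt_le)

lemma dist_le: "x \<sqsubseteq> y \<Longrightarrow> dist x y = ht y - ht x"
  using dist_pt[of "ht x" y "ht y"] unfolding le_iff by auto

lemma seg_eq: "seg \<rho> x = {y. y \<sqsubseteq> x}"
  by (auto simp: le_def)

section \<open>Meets and the distance formula\<close>

lemma continuous_on_pt: "continuous_on {0..ht y} (pt y)"
proof (rule continuous_onI)
  fix s e :: real assume "s \<in> {0..ht y}" "0 < e"
  then show "\<exists>d>0. \<forall>t\<in>{0..ht y}. dist t s < d \<longrightarrow> dist (pt y t) (pt y s) \<le> e"
    by (intro exI[of _ e]) (auto simp: dist_pt dist_real_def)
qed

text \<open>The common part of two root segments is compact, so it has a highest point; points below
  x are ordered by height, so the highest is the greatest.\<close>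

lemma ex_meet: "\<exists>m. m \<sqsubseteq> x \<and> m \<sqsubseteq> y \<and> (\<forall>z. z \<sqsubseteq> x \<longrightarrow> z \<sqsubseteq> y \<longrightarrow> z \<sqsubseteq> m)"
proof -
  define K where "K = seg \<rho> x \<inter> seg \<rho> y"
  have "compact (seg \<rho> x)" for x
    unfolding seg_eq_pt by (rule compact_continuous_image[OF continuous_on_pt]) simp
  then have "compact K" unfolding K_def by (simp add: compact_Int)
  moreover have "\<rho> \<in> K" by (simp add: K_def seg_eq)
  moreover have "continuous_on K (\<lambda>z. ht z)" by (intro continuous_intros)
  ultimately obtain m where "m \<in> K" "\<And>z. z \<in> K \<Longrightarrow> ht z \<le> ht m"
    using continuous_attains_sup[of K "\<lambda>z. ht z"] by blast
  then show ?thesis unfolding K_def seg_eq using le_below_linear by blast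
qed

definition meet :: "'a \<Rightarrow> 'a \<Rightarrow> 'a"  (infixl "\<sqinter>" 70) where
  "x \<sqinter> y = (SOME m. m \<sqsubseteq> x \<and> m \<sqsubseteq> y \<and> (\<forall>z. z \<sqsubseteq> x \<longrightarrow> z \<sqsubseteq> y \<longrightarrow> z \<sqsubseteq> m))"

lemma meet_le1 [simp]: "x \<sqinter> y \<sqsubseteq> x" and meet_le2 [simp]: "x \<sqinter> y \<sqsubseteq> y"
  and meet_greatest: "z \<sqsubseteq> x \<Longrightarrow> z \<sqsubseteq> y \<Longrightarrow> z \<sqsubseteq> x \<sqinter> y"
  using someI_ex[OF ex_meet[of x y], folded meet_def] by auto

lemma le_meet_iff: "z \<sqsubseteq> x \<sqinter> y \<longleftrightarrow> z \<sqsubseteq> x \<and> z \<sqsubseteq> y"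
  using meet_greatest le_trans meet_le1 meet_le2 by blast

lemma meet_commute: "x \<sqinter> y = y \<sqinter> x"
  by (meson le_antisym le_meet_iff meet_le1 meet_le2)

lemma meet_eq_left: "x \<sqsubseteq> y \<longleftrightarrow> x \<sqinter> y = x"
  by (metis le_antisym le_meet_iff le_refl meet_le1 meet_le2)

lemma meet_eq_iff_ht: "x \<sqsubseteq> y \<longleftrightarrow> ht x \<le> ht (x \<sqinter> y)"
  using meet_le1[of x y] meet_le2[of x y] meet_eq_left[of x y] le_eq_ht[of "x \<sqinter> y" x] by auto

text \<open>The height of the meet is the Gromov product at the root. The descent from x to the meet
  and the ascent to y share only the meet, so they glue to a segment; this is the one place where
  the gluing axiom enters.\<close>

lemma dist_meet: "dist x y = ht x + ht y - 2 * ht (x \<sqinter> y)"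
proof -
  define m where "m = x \<sqinter> y"
  have hm: "ht m \<le> ht x" "ht m \<le> ht y" "pt x (ht m) = m" "pt y (ht m) = m"
    using meet_le1 meet_le2 unfolding m_def le_iff by auto
  have I: "is_segment (pt x ` {ht m..ht x}) x m"
    using is_segment_pt_rev[of "ht m" "ht x" x] hm by simp
  have J: "is_segment (pt y ` {ht m..ht y}) m y"
    using is_segment_pt[of "ht m" "ht y" y] hm by simp
  have "pt x ` {ht m..ht x} \<inter> pt y ` {ht m..ht y} = {m}"
  proof (intro equalityI subsetI)
    fix z assume "z \<in> pt x ` {ht m..ht x} \<inter> pt y ` {ht m..ht y}"
    then obtain s t where st: "ht m \<le> s" "s \<le> ht x" "ht m \<le> t" "t \<le> ht y" "z = pt x s" "z = pt y t"
      by auto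
    then have "0 \<le> s" "0 \<le> t" by (meson order_trans zero_le_dist)+
    then have "z \<sqsubseteq> x" "z \<sqsubseteq> y" "ht z = s"
      using st pt_le[of s x] pt_le[of t y] ht_pt[of s x] by auto
    then have "z \<sqsubseteq> m" unfolding m_def by (simp add: le_meet_iff)
    then show "z \<in> {m}" using st \<open>ht z = s\<close> le_eq_ht by simp
  next
    fix z assume "z \<in> {m}"
    then show "z \<in> pt x ` {ht m..ht x} \<inter> pt y ` {ht m..ht y}"
      using hm by (metis IntI atLeastAtMost_iff imageI order_refl singletonD)
  qed
  from dist_segment[OF is_segment_glue[OF I J this], of m]
  have "dist x y = dist x m + dist m y" using hm by force
  then show ?thesis
    using dist_le[of m x] dist_le[of m y] m_def by (simp add: dist_commute)
qed

lemma continuous_ht_meet: "continuous_on A (\<lambda>y. ht (x \<sqinter> y))"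
proof -
  have eq: "(\<lambda>y. ht (x \<sqinter> y)) = (\<lambda>y. (ht x + ht y - dist x y) / 2)"
    using dist_meet[of x] by auto
  show ?thesis by (subst eq) (intro continuous_intros, simp)
qed

section \<open>Up-sets and the Borel sets\<close>

lemma closed_up: "closed (up x)"
proof -
  have "up x = {y. ht x \<le> ht (x \<sqinter> y)}" using meet_eq_iff_ht by auto
  then show ?thesis
    using closed_Collect_le[of "\<lambda>_. ht x" "\<lambda>y. ht (x \<sqinter> y)"] continuous_ht_meet by simp
qed

lemma up_borel [measurable]: "up x \<in> sets borel"
  by (simp add: borel_closed closed_up)

lemma up_root [simp]: "up \<rho> = UNIV"
  by auto

lemma up_mono: "x \<sqsubseteq> y \<Longrightarrow> up y \<subseteq> up x"
  using le_trans by auto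

lemma up_disjoint_or_le: "up x \<inter> up y \<noteq> {} \<Longrightarrow> x \<sqsubseteq> y \<or> y \<sqsubseteq> x"
  using le_below_cases mem_up by blast

text \<open>The Borel \<open>\<sigma>\<close>-algebra is generated by the sets \<^term>\<open>up x\<close>, because
  \<open>ht y\<close> is the supremum of \<open>ht (d \<sqinter> y)\<close> over a countable dense set of \<open>d\<close>.\<close>

lemma sets_borel_eq_sigma_up: "sets (borel :: 'a measure) = sigma_sets UNIV (range up)"
proof
  show "sigma_sets UNIV (range up) \<subseteq> sets borel"
    by (rule sets.sigma_sets_subset[of "range up" borel, simplified]) (use up_borel in auto)
next
  define M where "M = sigma UNIV (range up)"
  have setsM: "sets M = sigma_sets UNIV (range up)" and spM: "space M = UNIV"
    unfolding M_def by auto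
  have upM: "up x \<in> sets M" for x unfolding setsM by auto
  have mm: "(\<lambda>y. ht (x \<sqinter> y)) \<in> borel_measurable M" for x
  proof (rule borel_measurableI_ge)
    fix t :: real
    \<comment> \<open>For 0 < t \<le> \<open>ht x\<close>, the meet of x and y reaches height t
      exactly when y lies above the point at height t on the segment to x.\<close>
    have "{y \<in> space M. t \<le> ht (x \<sqinter> y)} =
      (if t \<le> 0 then UNIV else if ht x < t then {} else up (pt x t))"
    proof -
      have "t \<le> ht (x \<sqinter> y) \<longleftrightarrow> pt x t \<sqsubseteq> y" if "0 < t" "t \<le> ht x" for y
      proof
        assume t: "t \<le> ht (x \<sqinter> y)"
        then have "pt x t \<sqsubseteq> x \<sqinter> y" using pt_mem_iff_le that
          by (metis le_below_linear ht_pt less_eq_real_def meet_le1 pt_le)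
        then show "pt x t \<sqsubseteq> y" by (simp add: le_meet_iff)
      next
        assume "pt x t \<sqsubseteq> y"
        then have "pt x t \<sqsubseteq> x \<sqinter> y" using that by (simp add: le_meet_iff pt_le)
        then show "t \<le> ht (x \<sqinter> y)" using that le_ht ht_pt by fastforce
      qed
      moreover have "ht (x \<sqinter> y) \<le> ht x" for y using le_ht by simp
      ultimately show ?thesis
        unfolding spM by (auto simp: not_le intro: order_trans[OF _ zero_le_dist])
          (smt (verit) zero_le_dist)+
    qed
    then show "{y \<in> space M. t \<le> ht (x \<sqinter> y)} \<in> sets M"
      using upM sets.top[of M] spM by simp
  qed
  obtain D :: "'a set" where D: "countable D" "\<And>X. open X \<Longrightarrow> X \<noteq> {} \<Longrightarrow> \<exists>d\<in>D. d \<in> X"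
    by (rule countable_dense_setE) blast
  have "D \<noteq> {}" using D(2)[of UNIV] by auto
  have htM: "(\<lambda>y. ht y) \<in> borel_measurable M"
  proof -
    have bdd: "bdd_above ((\<lambda>d. ht (d \<sqinter> y)) ` D)" for y
      by (rule bdd_aboveI[of _ "ht y"]) (auto intro: le_ht)
    have sup: "(SUP d\<in>D. ht (d \<sqinter> y)) = ht y" for y
    proof (rule antisym)
      show "(SUP d\<in>D. ht (d \<sqinter> y)) \<le> ht y"
        using \<open>D \<noteq> {}\<close> by (intro cSUP_least) (auto intro: le_ht)
      show "ht y \<le> (SUP d\<in>D. ht (d \<sqinter> y))"
      proof (rule field_le_epsilon)
        fix e :: real assume "0 < e"
        then obtain d where d: "d \<in> D" "d \<in> ball y e"
          using D(2)[of "ball y e"] by auto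
        have "ht y - ht (d \<sqinter> y) \<le> dist d y" 
          using dist_meet[of d y] le_ht[of "d \<sqinter> y" d] by simp
        then have "ht y \<le> ht (d \<sqinter> y) + e" using d by (simp add: dist_commute)
        then show "ht y \<le> (SUP d\<in>D. ht (d \<sqinter> y)) + e"
          using cSUP_upper[OF d(1) bdd[of y]] by linarith
      qed
    qed
    have "(\<lambda>y. SUP d\<in>D. ht (d \<sqinter> y)) \<in> borel_measurable M"
      by (intro borel_measurable_cSUP D(1) mm bdd)
    then show ?thesis unfolding sup .
  qed
  \<comment> \<open>The distance formula expresses distances by heights of points and of meets.
    Balls suffice by the Lindelof property.\<close>
  have ballM: "ball x e \<in> sets M" for x e
  proof -
    have "(\<lambda>y. dist x y) = (\<lambda>y. ht x + ht y - 2 * ht (x \<sqinter> y))"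
      by (rule ext) (rule dist_meet)
    moreover have "(\<lambda>y. ht x + ht y - 2 * ht (x \<sqinter> y)) \<in> borel_measurable M"
      by (intro borel_measurable_add borel_measurable_diff borel_measurable_times borel_measurable_const htM mm)
    ultimately have "(\<lambda>y. dist x y) \<in> borel_measurable M" by (simp only:)
    then have "{y \<in> space M. dist x y < e} \<in> sets M" by measurable
    moreover have "{y \<in> space M. dist x y < e} = ball x e" unfolding spM by auto
    ultimately show ?thesis by simp
  qed
  have "U \<in> sets M" if "open U" for U :: "'a set"
  proof -
    have "\<exists>e>0. ball x e \<subseteq> U" if "x \<in> U" for x
      using \<open>open U\<close> that open_contains_ball by blast
    then obtain e where e: "\<And>x. x \<in> U \<Longrightarrow> e x > 0 \<and> ball x (e x) \<subseteq> U" by metis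
    obtain F' where F': "F' \<subseteq> (\<lambda>x. ball x (e x)) ` U" "countable F'" "\<Union>F' = \<Union>((\<lambda>x. ball x (e x)) ` U)"
      by (rule Lindelof[of "(\<lambda>x. ball x (e x)) ` U"]) auto
    have "U = \<Union>F'" unfolding F'(3) using e by force
    moreover have "\<Union>F' \<in> sets M"
      by (rule sets.countable_Union[OF F'(2)]) (use F'(1) ballM in auto)
    ultimately show ?thesis by simp
  qed
  then have "sigma_sets UNIV {U :: 'a set. open U} \<subseteq> sets M"
    using sets.sigma_sets_subset[of "{U :: 'a set. open U}" M] spM by auto
  then show "sets (borel :: 'a measure) \<subseteq> sigma_sets UNIV (range up)"
    unfolding setsM borel_def by simp
qed

section \<open>Branches and degrees\<close>

lemma strict_le_trans: "x \<sqsubset> y \<Longrightarrow> y \<sqsubseteq> z \<Longrightarrow> x \<sqsubset> z"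
  using le_trans le_antisym by blast

text \<open>The component containing y of the part strictly above \<tau>, as an equivalence class
  for "meeting strictly above \<tau>". It is empty unless y is strictly above \<tau>.\<close>

definition branch :: "'a \<Rightarrow> 'a \<Rightarrow> 'a set" where
  "branch \<tau> y = {z. \<tau> \<sqsubset> y \<sqinter> z}"

text \<open>Branches are taken in the whole tree and not intersected with D, so that the directions
  of different sets D at one point can be compared as sets.\<close>

definition dirs :: "'a set \<Rightarrow> 'a \<Rightarrow> 'a set set" where
  "dirs D \<tau> = branch \<tau> ` {y\<in>D. \<tau> \<sqsubset> y}"

lemma branch_self: "\<tau> \<sqsubset> y \<Longrightarrow> y \<in> branch \<tau> y"
  using meet_eq_left[of y y] by (simp add: branch_def)

lemma mem_branch_less: "z \<in> branch \<tau> y \<Longrightarrow> \<tau> \<sqsubset> z \<and> \<tau> \<sqsubset> y"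
  using strict_le_trans[OF _ meet_le1, of \<tau> y z] strict_le_trans[OF _ meet_le2, of \<tau> y z]
  unfolding branch_def mem_Collect_eq by blast

lemma branch_sym: "z \<in> branch \<tau> y \<Longrightarrow> y \<in> branch \<tau> z"
  unfolding branch_def using meet_commute[of y z] by simp

text \<open>Both meets lie below z, hence are comparable, and the lower one is below y and
  w.\<close>

lemma branch_trans: "z \<in> branch \<tau> y \<Longrightarrow> w \<in> branch \<tau> z \<Longrightarrow> w \<in> branch \<tau> y"
proof -
  assume "z \<in> branch \<tau> y" "w \<in> branch \<tau> z"
  then have *: "\<tau> \<sqsubset> y \<sqinter> z" "\<tau> \<sqsubset> z \<sqinter> w" by (auto simp: branch_def)
  have "y \<sqinter> z \<sqsubseteq> z \<sqinter> w \<or> z \<sqinter> w \<sqsubseteq> y \<sqinter> z"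
    by (rule le_below_cases[of _ z]) auto
  then have "y \<sqinter> z \<sqsubseteq> y \<sqinter> w \<or> z \<sqinter> w \<sqsubseteq> y \<sqinter> w"
    by (auto simp: le_meet_iff)
  then have "\<tau> \<sqsubset> y \<sqinter> w" using * strict_le_trans by blast
  then show ?thesis by (simp add: branch_def)
qed

lemma branch_eq: "z \<in> branch \<tau> y \<Longrightarrow> branch \<tau> z = branch \<tau> y"
  using branch_trans branch_sym by blast

lemma open_branch: "open (branch \<tau> y)"
proof (cases "\<tau> \<sqsubseteq> y")
  case True
  have "branch \<tau> y = {z. ht \<tau> < ht (y \<sqinter> z)}"
  proof (intro set_eqI iffI)
    fix z assume "z \<in> {z. ht \<tau> < ht (y \<sqinter> z)}"
    then show "z \<in> branch \<tau> y"
      using le_below_linear[OF True meet_le1[of y z]] by (auto simp: branch_def)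
  qed (auto simp: branch_def less_ht)
  then show ?thesis
    using open_Collect_less[of "\<lambda>_. ht \<tau>" "\<lambda>z. ht (y \<sqinter> z)"] continuous_ht_meet by simp
next
  case False
  then have "branch \<tau> y = {}" using mem_branch_less by blast
  then show ?thesis by simp
qed

section \<open>Components of a punctured subtree\<close>

lemma connected_starlike:
  assumes "\<And>z. z \<in> S \<Longrightarrow> \<exists>T\<subseteq>S. connected T \<and> x \<in> T \<and> z \<in> T"
  shows "connected S"
proof (cases "S = {}")
  case False
  obtain T where T: "\<And>z. z \<in> S \<Longrightarrow> T z \<subseteq> S \<and> connected (T z) \<and> x \<in> T z \<and> z \<in> T z"
    using assms by metis
  have "connected (\<Union>(T ` S))"
    by (rule connected_Union) (use T False in auto)
  moreover have "\<Union>(T ` S) = S" using T by auto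
  ultimately show ?thesis by simp
qed simp

lemma connected_pt: "0 \<le> s \<Longrightarrow> t \<le> ht y \<Longrightarrow> connected (pt y ` {s..t})"
  by (rule connected_continuous_image[OF continuous_on_subset[OF continuous_on_pt[of y]]]) auto

text \<open>Any z in the branch is joined to x through their meet. This path stays strictly above
  \<tau>, and in D because D is closed downwards.\<close>

lemma connected_Int_branch:
  assumes D: "\<And>x w. x \<in> D \<Longrightarrow> w \<sqsubseteq> x \<Longrightarrow> w \<in> D" and x: "x \<in> D"
  shows "connected (D \<inter> branch \<tau> x)"
proof (rule connected_starlike[where x = x])
  fix z assume z: "z \<in> D \<inter> branch \<tau> x"
  define m where "m = x \<sqinter> z"
  have m: "\<tau> \<sqsubset> m" "m \<sqsubseteq> x" "m \<sqsubseteq> z" using z by (auto simp: branch_def m_def)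
  define T where "T = pt x ` {ht m..ht x} \<union> pt z ` {ht m..ht z}"
  have mem: "m \<in> pt x ` {ht m..ht x}" "m \<in> pt z ` {ht m..ht z}"
    using m le_iff by (metis atLeastAtMost_iff imageI order_refl)+
  have ends: "x \<in> T" "z \<in> T"
    using m le_ht pt_ht unfolding T_def by (metis UnCI atLeastAtMost_iff imageI order_refl)+
  have "connected T" unfolding T_def
    by (rule connected_Un) (use mem in \<open>auto intro!: connected_pt\<close>)
  moreover have "w \<in> D \<inter> branch \<tau> x" if "w \<in> T" for w
  proof -
    have "m \<sqsubseteq> w \<and> (w \<sqsubseteq> x \<or> w \<sqsubseteq> z)"
    proof -
      have *: "m \<sqsubseteq> pt y t \<and> pt y t \<sqsubseteq> y" if "m \<sqsubseteq> y" "ht m \<le> t" "t \<le> ht y" for y t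
        using that pt_mem_iff_le[of t y m] pt_le[of t y] order_trans[OF zero_le_dist that(2)] by auto
      show ?thesis using \<open>w \<in> T\<close> * m unfolding T_def by auto
    qed
    then show ?thesis
      using D x z m strict_le_trans[of \<tau> m "x \<sqinter> w"] by (auto simp: branch_def le_meet_iff)
  qed
  ultimately show "\<exists>T\<subseteq>D \<inter> branch \<tau> x. connected T \<and> x \<in> T \<and> z \<in> T"
    using ends by blast
qed

lemma connected_minus_up:
  assumes D: "\<And>x w. x \<in> D \<Longrightarrow> w \<sqsubseteq> x \<Longrightarrow> w \<in> D"
  shows "connected (D - up \<tau>)"
proof (rule connected_starlike[where x = \<rho>])
  fix z assume z: "z \<in> D - up \<tau>"
  have "pt z ` {0..ht z} \<subseteq> D - up \<tau>"
    using z D pt_le le_trans by auto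
  moreover have "\<rho> \<in> pt z ` {0..ht z}" "z \<in> pt z ` {0..ht z}"
    using pt_0 pt_ht by (metis atLeastAtMost_iff imageI order_refl zero_le_dist)+
  ultimately show "\<exists>T\<subseteq>D - up \<tau>. connected T \<and> \<rho> \<in> T \<and> z \<in> T"
    using connected_pt[of 0 "ht z" z] by blast
qed

text \<open>The branches at \<tau> and the complement of \<open>up \<tau>\<close> are disjoint open
  sets covering everything but \<tau>, and each meets D in a connected set. The piece containing the
  root disappears when \<tau> is the root.\<close>

lemma components_minus_point:
  assumes D: "\<And>x w. x \<in> D \<Longrightarrow> w \<sqsubseteq> x \<Longrightarrow> w \<in> D" and "\<tau> \<in> D"
  shows "components (D - {\<tau>}) = (\<inter>) D ` dirs D \<tau> \<union> (if \<tau> = \<rho> then {} else {D - up \<tau>})"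
proof -
  define cls where "cls x = (if \<tau> \<sqsubseteq> x then branch \<tau> x else - up \<tau>)" for x
  have self: "x \<in> cls x" if "x \<noteq> \<tau>" for x
    using that branch_self[of \<tau> x] by (auto simp: cls_def)
  have ntau: "\<tau> \<notin> cls x" for x
    using mem_branch_less[of \<tau> \<tau> x] by (auto simp: cls_def)
  have op: "open (cls x)" for x
    using open_branch closed_up by (auto simp: cls_def)
  have eq: "cls z = cls x" if "z \<in> cls x" for x z
  proof (cases "\<tau> \<sqsubseteq> x")
    case True
    then show ?thesis using that branch_eq[of z \<tau> x] mem_branch_less[of z \<tau> x] by (simp add: cls_def)
  next
    case False
    then show ?thesis using that by (simp add: cls_def)
  qed
  have ccs: "connected_component_set (D - {\<tau>}) x = D \<inter> cls x" if x: "x \<in> D - {\<tau>}" for x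
  proof
    show "D \<inter> cls x \<subseteq> connected_component_set (D - {\<tau>}) x"
    proof (rule connected_component_maximal)
      show "connected (D \<inter> cls x)"
        using connected_Int_branch[of D x \<tau>] connected_minus_up[of D \<tau>] D x
        by (auto simp: cls_def Diff_eq)
    qed (use x self ntau[of x] in auto)
  next
    define C where "C = connected_component_set (D - {\<tau>}) x"
    have C: "connected C" "C \<subseteq> D - {\<tau>}" "x \<in> C"
      unfolding C_def using connected_component_subset x by auto
    \<comment> \<open>Otherwise the class of x and the union of the other classes would be two open
      sets separating the connected set C.\<close>
    have "\<not> (\<exists>z\<in>C. z \<notin> cls x)"
    proof
      assume "\<exists>z\<in>C. z \<notin> cls x"
      then have "(\<Union>z\<in>C - cls x. cls z) \<inter> C \<noteq> {}" using self C(2) by blast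
      moreover have "cls x \<inter> C \<noteq> {}" using C self x by auto
      moreover have "C \<subseteq> cls x \<union> (\<Union>z\<in>C - cls x. cls z)" using self C(2) by blast
      moreover have "cls x \<inter> (\<Union>z\<in>C - cls x. cls z) \<inter> C = {}"
      proof -
        have False if "z \<in> C" "z \<notin> cls x" "w \<in> cls x" "w \<in> cls z" for z w
          using eq[OF that(3)] eq[OF that(4)] self[of z] that C(2) by auto
        then show ?thesis by blast
      qed
      ultimately show False
        using C(1) op unfolding connected_def by (meson open_UN)
    qed
    then show "connected_component_set (D - {\<tau>}) x \<subseteq> D \<inter> cls x"
      using C(2) unfolding C_def by auto
  qed
  have "components (D - {\<tau>}) = (\<lambda>x. D \<inter> cls x) ` (D - {\<tau>})"
    unfolding components_def using ccs by simp
  also have "\<dots> = (\<lambda>x. D \<inter> cls x) ` ({y\<in>D. \<tau> \<sqsubset> y} \<union> (D - up \<tau>))"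
    by (rule arg_cong[of _ _ "(`) (\<lambda>x. D \<inter> cls x)"]) auto
  also have "\<dots> = (\<lambda>x. D \<inter> branch \<tau> x) ` {y\<in>D. \<tau> \<sqsubset> y} \<union> (\<lambda>x. D - up \<tau>) ` (D - up \<tau>)"
    unfolding image_Un by (rule arg_cong2[of _ _ _ _ "(\<union>)"]) (auto simp: cls_def Diff_eq intro!: image_cong)
  also have "(\<lambda>x. D \<inter> branch \<tau> x) ` {y\<in>D. \<tau> \<sqsubset> y} = (\<inter>) D ` dirs D \<tau>"
    by (simp add: dirs_def image_image)
  also have "(\<lambda>x. D - up \<tau>) ` (D - up \<tau>) = (if \<tau> = \<rho> then {} else {D - up \<tau>})"
  proof (cases "\<tau> = \<rho>")
    case False
    then have "\<rho> \<in> D - up \<tau>" using D[OF \<open>\<tau> \<in> D\<close>, of \<rho>] by (simp add: le_root)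
    then show ?thesis using False by auto
  qed simp
  finally show ?thesis .
qed

text \<open>The extra 1 off the root counts the component containing the root. Intersecting with D
  merges no directions, since each direction of D contains a point of D.\<close>

lemma degree_eq:
  assumes D: "\<And>x w. x \<in> D \<Longrightarrow> w \<sqsubseteq> x \<Longrightarrow> w \<in> D" and "\<tau> \<in> D"
  shows "degree \<tau> D = (if finite (dirs D \<tau>) then enat (card (dirs D \<tau>) + (if \<tau> = \<rho> then 0 else 1)) else \<infinity>)"
proof -
  have inj: "inj_on ((\<inter>) D) (dirs D \<tau>)"
  proof (rule inj_onI)
    fix A B assume "A \<in> dirs D \<tau>" "B \<in> dirs D \<tau>" and eq: "D \<inter> A = D \<inter> B"
    then obtain y z where yz: "y \<in> D" "\<tau> \<sqsubset> y" "A = branch \<tau> y" "z \<in> D" "\<tau> \<sqsubset> z" "B = branch \<tau> z"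
      unfolding dirs_def by blast
    then have "y \<in> B" using eq branch_self[of \<tau> y] by blast
    then show "A = B" using yz branch_eq by simp
  qed
  have fin: "finite ((\<inter>) D ` dirs D \<tau>) \<longleftrightarrow> finite (dirs D \<tau>)"
    by (rule finite_image_iff[OF inj])
  have "D - up \<tau> \<notin> (\<inter>) D ` dirs D \<tau>"
  proof
    assume "D - up \<tau> \<in> (\<inter>) D ` dirs D \<tau>"
    then obtain y where y: "y \<in> D" "\<tau> \<sqsubset> y" "D - up \<tau> = D \<inter> branch \<tau> y"
      unfolding dirs_def by blast
    then show False using branch_self[of \<tau> y] by auto
  qed
  moreover have "components (D - {\<tau>}) = (\<inter>) D ` dirs D \<tau> \<union> (if \<tau> = \<rho> then {} else {D - up \<tau>})"
    by (rule components_minus_point) (use assms in auto)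
  ultimately show ?thesis
    unfolding degree_def using fin card_image[OF inj]
    by (cases "\<tau> = \<rho>") (simp_all add: card_insert_if)
qed

text \<open>Adding a point \<open>p\<close> to an antichain \<open>F\<close> creates one new direction, at the highest of the
  points \<open>p \<sqinter> f\<close> with \<open>f \<in> F\<close>.\<close>

lemma card_antichain:
  assumes "finite F" "F \<noteq> {}" "finite M"
    and "\<And>x y. x \<in> F \<Longrightarrow> y \<in> F \<Longrightarrow> x \<sqsubseteq> y \<Longrightarrow> x = y"
    and "\<And>x y. x \<in> F \<Longrightarrow> y \<in> F \<Longrightarrow> x \<sqinter> y \<in> M"
  shows "(\<Sum>\<tau>\<in>M. card (dirs F \<tau>) - 1) + 1 = card F"
  using assms(1,2,4,5)
proof (induction F rule: finite_ne_induct)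
  case (singleton x)
  have "card (dirs {x} \<tau>) - 1 = 0" for \<tau>
  proof -
    have "dirs {x} \<tau> \<subseteq> {branch \<tau> x}" unfolding dirs_def by auto
    then have "card (dirs {x} \<tau>) \<le> card {branch \<tau> x}" by (intro card_mono) auto
    then show ?thesis by simp
  qed
  then show ?case by simp
next
  case (insert p F)
  have "Max ((\<lambda>f. ht (p \<sqinter> f)) ` F) \<in> (\<lambda>f. ht (p \<sqinter> f)) ` F"
    using insert.hyps(1,2) by (intro Max_in) auto
  then obtain f where f0: "f \<in> F" "ht (p \<sqinter> f) = Max ((\<lambda>f. ht (p \<sqinter> f)) ` F)" by auto
  define q where "q = p \<sqinter> f"
  have f: "f \<in> F" "\<And>g. g \<in> F \<Longrightarrow> ht (p \<sqinter> g) \<le> ht q"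
    using f0 insert.hyps(1) unfolding q_def by auto
  have fp: "\<not> p \<sqsubseteq> f" "\<not> f \<sqsubseteq> p" using insert.prems(1)[of p f] insert.prems(1)[of f p] insert.hyps(3) f(1) by auto
  have qp: "q \<sqsubseteq> p" "q \<sqsubseteq> f" unfolding q_def by auto
  then have qp': "q \<sqsubset> p" "q \<sqsubset> f" using fp by auto
  have dirs_insert: "dirs (insert p F) \<tau> = (if \<tau> \<sqsubset> p then insert (branch \<tau> p) (dirs F \<tau>) else dirs F \<tau>)" for \<tau>
    unfolding dirs_def by auto
  have finF: "finite (dirs F \<tau>)" for \<tau> unfolding dirs_def using insert.hyps(1) by simp
  \<comment> \<open>At q the direction towards f is already present, so the natural-number
    subtraction does not truncate and the new direction counts in full.\<close>
  have at_q: "card (dirs (insert p F) q) - 1 = card (dirs F q) - 1 + 1"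
  proof -
    have "branch q p \<notin> dirs F q"
    proof
      assume "branch q p \<in> dirs F q"
      then obtain g where g: "g \<in> F" "q \<sqsubset> g" "branch q p = branch q g" unfolding dirs_def by blast
      then have "g \<in> branch q p" using branch_self by blast
      then have "q \<sqsubset> p \<sqinter> g" by (simp add: branch_def)
      then show False using f(2)[OF g(1)] less_ht by fastforce
    qed
    moreover have "dirs F q \<noteq> {}" using f(1) qp' unfolding dirs_def by auto
    then have "card (dirs F q) \<ge> 1" using finF[of q] by (simp add: Suc_le_eq card_gt_0_iff)
    ultimately show ?thesis unfolding dirs_insert using qp' finF by simp
  qed
  \<comment> \<open>Below q the direction to p is the one to f. On the segment from q to p there was
    no direction before, so the count goes from 0 to 1, which the truncated subtraction does not
    see.\<close>
  have off_q: "card (dirs (insert p F) \<tau>) - 1 = card (dirs F \<tau>) - 1" if "\<tau> \<noteq> q" for \<tau>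
  proof (cases "\<tau> \<sqsubset> p")
    case tp: True
    show ?thesis
    proof (cases "\<tau> \<sqsubseteq> q")
      case True
      then have "\<tau> \<sqsubset> f" "f \<in> branch \<tau> p"
        using that strict_le_trans[of \<tau> q f] qp by (auto simp: branch_def q_def)
      then have "branch \<tau> p \<in> dirs F \<tau>"
        using f(1) branch_eq[of f \<tau> p] unfolding dirs_def by auto
      then show ?thesis unfolding dirs_insert by (simp add: insert_absorb)
    next
      case False
      have "dirs F \<tau> = {}"
      proof -
        have False if g: "g \<in> F" "\<tau> \<sqsubset> g" for g
        proof -
          have "\<tau> \<sqsubseteq> p \<sqinter> g" using g tp by (simp add: le_meet_iff)
          then have "ht \<tau> \<le> ht q" using f(2)[OF g(1)] le_ht by fastforce
          then show False using False le_below_linear[of \<tau> p q] tp qp by simp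
        qed
        then show ?thesis unfolding dirs_def by auto
      qed
      then show ?thesis unfolding dirs_insert by simp
    qed
  next
    case False
    then show ?thesis unfolding dirs_insert by (simp only: if_False)
  qed
  have qM: "q \<in> M" unfolding q_def using insert.prems(2)[of p f] f(1) by simp
  have "(\<Sum>\<tau>\<in>M. card (dirs (insert p F) \<tau>) - 1) = (\<Sum>\<tau>\<in>M. card (dirs F \<tau>) - 1) + 1"
    unfolding sum.remove[OF \<open>finite M\<close> qM] using at_q off_q by simp
  moreover have "(\<Sum>\<tau>\<in>M. card (dirs F \<tau>) - 1) + 1 = card F"
    by (rule insert.IH) (use insert.prems in auto)
  ultimately show ?case using insert.hyps by simp
qed

section \<open>Projections and level sets\<close>

lemma mem_up_limit:
  assumes "\<And>n. x n \<sqsubseteq> w" "\<And>n. x n \<sqsubseteq> z" "(\<lambda>n. ht (x n)) \<longlonglongrightarrow> ht z"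
  shows "z \<sqsubseteq> w"
proof -
  have "ht (x n) \<le> ht (z \<sqinter> w)" for n
    using assms(1,2) le_ht by (simp add: le_meet_iff)
  then have "ht z \<le> ht (z \<sqinter> w)"
    by (intro LIMSEQ_le_const2[OF assms(3)]) auto
  then show ?thesis using meet_eq_iff_ht by blast
qed

text \<open>Closedness is put in terms of the order: the last clause asks only for limits along a
  segment from the root, which is what projecting to D requires.\<close>

definition rooted_subtree :: "'a set \<Rightarrow> bool" where
  "rooted_subtree D \<longleftrightarrow> \<rho> \<in> D \<and> (\<forall>x\<in>D. \<forall>w. w \<sqsubseteq> x \<longrightarrow> w \<in> D) \<and>
     (\<forall>y. (\<forall>x. x \<sqsubset> y \<longrightarrow> x \<in> D) \<longrightarrow> y \<in> D)"

lemma rooted_subtreeD: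
  assumes "rooted_subtree D"
  shows "\<rho> \<in> D" "x \<in> D \<Longrightarrow> w \<sqsubseteq> x \<Longrightarrow> w \<in> D" "(\<And>x. x \<sqsubset> y \<Longrightarrow> x \<in> D) \<Longrightarrow> y \<in> D"
  using assms unfolding rooted_subtree_def by blast+

text \<open>The projection sits at the supremum of the heights at which the segment to y is in D;
  the last clause of \<open>rooted_subtree\<close> makes this supremum attained.\<close>

lemma tree_proj_props:
  assumes D: "rooted_subtree D"
  shows "tree_proj \<rho> D y \<in> D \<and> tree_proj \<rho> D y \<sqsubseteq> y \<and> (\<forall>x\<in>D. x \<sqsubseteq> y \<longrightarrow> x \<sqsubseteq> tree_proj \<rho> D y)"
proof -
  define K where "K = {t\<in>{0..ht y}. pt y t \<in> D}"
  define s where "s = Sup K"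
  define f where "f = pt y s"
  have K0: "0 \<in> K" using rooted_subtreeD(1)[OF D] by (simp add: K_def)
  have bdd: "bdd_above K" by (rule bdd_aboveI[of _ "ht y"]) (simp add: K_def)
  have "0 \<le> s" unfolding s_def by (rule cSup_upper[OF K0 bdd])
  moreover have "s \<le> ht y"
    unfolding s_def by (rule cSup_least, use K0 in blast) (simp add: K_def)
  ultimately have s: "0 \<le> s" "s \<le> ht y" by auto
  have fy: "f \<sqsubseteq> y" and hf: "ht f = s" unfolding f_def using s pt_le ht_pt by auto
  have "f \<in> D"
  proof (rule rooted_subtreeD(3)[OF D])
    fix x assume x: "x \<sqsubset> f"
    then have "ht x < s" using less_ht hf by metis
    then obtain t where t: "t \<in> K" "ht x < t"
      unfolding s_def using less_cSup_iff[OF _ bdd] K0 by blast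
    have "x \<sqsubseteq> pt y t"
      using t x fy le_trans[of x f y] by (subst pt_mem_iff_le) (auto simp: K_def)
    then show "x \<in> D" using t(1) rooted_subtreeD(2)[OF D] unfolding K_def by blast
  qed
  have mx: "x \<sqsubseteq> f" if "x \<in> D" "x \<sqsubseteq> y" for x
  proof -
    have "ht x \<in> K" using that le_iff by (auto simp: K_def)
    then have "ht x \<le> s" unfolding s_def by (rule cSup_upper[OF _ bdd])
    then show ?thesis using le_below_linear[OF that(2) fy] hf by simp
  qed
  have "tree_proj \<rho> D y = f"
    unfolding tree_proj_def
  proof (rule the_equality)
    show eq: "seg \<rho> y \<inter> D = seg \<rho> f"
      unfolding seg_eq using mx le_trans[OF _ fy] rooted_subtreeD(2)[OF D \<open>f \<in> D\<close>] by auto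
    fix \<tau> assume "seg \<rho> y \<inter> D = seg \<rho> \<tau>"
    then have "{x. x \<sqsubseteq> f} = {x. x \<sqsubseteq> \<tau>}" using eq by (simp add: seg_eq)
    then show "\<tau> = f" using le_antisym le_refl by (metis mem_Collect_eq)
  qed
  then show ?thesis using \<open>f \<in> D\<close> fy mx by blast
qed

lemma tree_proj_mem: "rooted_subtree D \<Longrightarrow> tree_proj \<rho> D y \<in> D"
  using tree_proj_props by blast

lemma le_tree_proj_iff: "rooted_subtree D \<Longrightarrow> x \<in> D \<Longrightarrow> x \<sqsubseteq> tree_proj \<rho> D y \<longleftrightarrow> x \<sqsubseteq> y"
  using tree_proj_props[of D y] le_trans by blast

lemma tree_proj_fixed_iff: "rooted_subtree D \<Longrightarrow> tree_proj \<rho> D y = y \<longleftrightarrow> y \<in> D"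
  using tree_proj_props[of D y] le_antisym le_refl by metis

text \<open>Everything below a projected point is in D. So the preimage of a generator
  \<open>up \<sigma>\<close> is \<open>up \<sigma>\<close> itself for \<sigma> in D, and empty
  otherwise.\<close>

lemma tree_proj_measurable:
  assumes D: "rooted_subtree D"
  shows "tree_proj \<rho> D \<in> borel \<rightarrow>\<^sub>M borel"
proof (rule measurable_sigma_sets[OF sets_borel_eq_sigma_up])
  fix A assume "A \<in> range up"
  then obtain \<sigma> where A: "A = up \<sigma>" by blast
  have "tree_proj \<rho> D -` A = (if \<sigma> \<in> D then up \<sigma> else {})"
    using le_tree_proj_iff[OF D] rooted_subtreeD(2)[OF D tree_proj_mem[OF D]] unfolding A by auto
  then show "tree_proj \<rho> D -` A \<inter> space borel \<in> sets borel" by simp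
qed auto

lemma rooted_subtree_borel:
  assumes D: "rooted_subtree D"
  shows "D \<in> sets borel"
proof -
  have "{y \<in> space borel. tree_proj \<rho> D y = y} \<in> sets borel"
    using tree_proj_measurable[OF D] by measurable
  then show ?thesis using tree_proj_fixed_iff[OF D] by simp
qed

text \<open>For \<open>r > 0\<close> these are the skeleton points at height \<open>r\<close>; there are none if \<open>\<mu>\<close> is finite,
  so that the finite and the discretely infinite case can be treated together.\<close>

definition top_points :: "'a measure \<Rightarrow> real \<Rightarrow> 'a set" where
  "top_points \<mu> r = {e. ht e = r \<and> emeasure \<mu> (up e) = \<infinity>}"

text \<open>This is not a ball: subtrees of finite mass that reach beyond height r are kept whole,
  so an up-set of finite mass based in the trunk lies entirely in it.\<close>

definition trunk :: "'a measure \<Rightarrow> real \<Rightarrow> 'a set" where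
  "trunk \<mu> r = {y. \<forall>e\<in>top_points \<mu> r. \<not> e \<sqsubseteq> y}"

text \<open>What finite and discretely infinite measures have in common, in a form that erasure
  preserves. The last clause is closedness of the skeleton along segments. The root must be
  exempted: nothing lies strictly below it, so the clause would force infinite total mass.\<close>

definition tame :: "'a measure \<Rightarrow> bool" where
  "tame \<mu> \<longleftrightarrow> sets \<mu> = sets borel \<and>
     (\<forall>r>0. finite (top_points \<mu> r) \<and> emeasure \<mu> (trunk \<mu> r) < \<infinity>) \<and>
     (\<forall>y. y \<noteq> \<rho> \<longrightarrow> (\<forall>x. x \<sqsubset> y \<longrightarrow> emeasure \<mu> (up x) = \<infinity>) \<longrightarrow> emeasure \<mu> (up y) = \<infinity>)"

lemma tameD:
  assumes "tame \<mu>"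
  shows "sets \<mu> = sets borel" "space \<mu> = UNIV"
    "0 < r \<Longrightarrow> finite (top_points \<mu> r)" "0 < r \<Longrightarrow> emeasure \<mu> (trunk \<mu> r) < \<infinity>"
    "y \<noteq> \<rho> \<Longrightarrow> (\<And>x. x \<sqsubset> y \<Longrightarrow> emeasure \<mu> (up x) = \<infinity>) \<Longrightarrow> emeasure \<mu> (up y) = \<infinity>"
  using assms sets_eq_imp_space_eq[of \<mu> borel] unfolding tame_def by auto

section \<open>Cutting at skeleton points\<close>

lemma emeasure_up_antimono:
  "sets \<mu> = sets borel \<Longrightarrow> x \<sqsubseteq> y \<Longrightarrow> emeasure \<mu> (up y) \<le> emeasure \<mu> (up x)"
  by (rule emeasure_mono[OF up_mono]) simp_all

lemma top_points_antichain: "e \<in> top_points \<mu> r \<Longrightarrow> e' \<in> top_points \<mu> r \<Longrightarrow> e \<sqsubseteq> e' \<Longrightarrow> e = e'"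
  using le_eq_ht by (simp add: top_points_def)

lemma trunk_down: "y \<in> trunk \<mu> r \<Longrightarrow> x \<sqsubseteq> y \<Longrightarrow> x \<in> trunk \<mu> r"
  unfolding trunk_def using le_trans by blast

lemma mem_trunk: "ht y < r \<Longrightarrow> y \<in> trunk \<mu> r"
  unfolding trunk_def top_points_def using le_ht by fastforce

text \<open>Mass grows towards the root, so below each cut point at the larger height there is a cut
  point at the smaller one.\<close>

lemma trunk_mono:
  assumes "sets \<mu> = sets borel" "0 \<le> r" "r \<le> r'"
  shows "trunk \<mu> r \<subseteq> trunk \<mu> r'"
proof
  fix y assume y: "y \<in> trunk \<mu> r"
  have "\<not> e \<sqsubseteq> y" if e: "e \<in> top_points \<mu> r'" for e
  proof
    assume "e \<sqsubseteq> y"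
    have re: "r \<le> ht e" and inf: "emeasure \<mu> (up e) = \<infinity>" using e assms(3) by (auto simp: top_points_def)
    have "emeasure \<mu> (up (pt e r)) = \<infinity>"
      using emeasure_up_antimono[OF assms(1) pt_le[OF assms(2) re]] inf by (simp add: top_unique)
    then have "pt e r \<in> top_points \<mu> r" using ht_pt[OF assms(2) re] by (simp add: top_points_def)
    moreover have "pt e r \<sqsubseteq> y" using pt_le[OF assms(2) re] \<open>e \<sqsubseteq> y\<close> le_trans by blast
    ultimately show False using y by (simp add: trunk_def)
  qed
  then show "y \<in> trunk \<mu> r'" by (simp add: trunk_def)
qed

lemma trunk_borel: "finite (top_points \<mu> r) \<Longrightarrow> trunk \<mu> r \<in> sets borel"
proof -
  assume "finite (top_points \<mu> r)"
  then have "(\<Union>e\<in>top_points \<mu> r. up e) \<in> sets borel" by (intro sets.finite_UN) auto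
  moreover have "trunk \<mu> r = UNIV - (\<Union>e\<in>top_points \<mu> r. up e)" by (auto simp: trunk_def)
  ultimately show ?thesis by (metis sets.compl_sets space_borel)
qed

lemma up_subset_trunk:
  assumes "y \<in> trunk \<mu> r" "\<And>e. e \<in> top_points \<mu> r \<Longrightarrow> \<not> y \<sqsubseteq> e"
  shows "up y \<subseteq> trunk \<mu> r"
  using assms le_below_cases unfolding trunk_def mem_up subset_iff by blast

lemma finite_mass_up_subset_trunk:
  assumes "sets \<mu> = sets borel" "y \<in> trunk \<mu> r" "emeasure \<mu> (up y) < \<infinity>"
  shows "up y \<subseteq> trunk \<mu> r"
proof (rule up_subset_trunk[OF assms(2)])
  fix e assume "e \<in> top_points \<mu> r"
  then show "\<not> y \<sqsubseteq> e"
    using emeasure_up_antimono[OF assms(1), of y e] assms(3) by (auto simp: top_points_def top_unique)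
qed

lemma emeasure_up_limit:
  assumes "sets \<mu> = sets borel" "\<And>n. x n \<sqsubseteq> x (Suc n)" "\<And>n. x n \<sqsubseteq> z" "(\<lambda>n. ht (x n)) \<longlonglongrightarrow> ht z"
    and fin: "emeasure \<mu> (up (x 0)) < \<infinity>" and ge: "\<And>n. c \<le> emeasure \<mu> (up (x n))"
  shows "c \<le> emeasure \<mu> (up z)"
proof -
  have "(\<Inter>n. up (x n)) = up z"
    using mem_up_limit[OF _ assms(3,4)] le_trans[OF assms(3)] by auto
  moreover have "(INF n. emeasure \<mu> (up (x n))) = emeasure \<mu> (\<Inter>n. up (x n))"
  proof (rule INF_emeasure_decseq')
    show "decseq (\<lambda>n. up (x n))" by (rule decseq_SucI) (rule up_mono[OF assms(2)])
    show "\<exists>i. emeasure \<mu> (up (x i)) \<noteq> \<infinity>" using fin by (intro exI[of _ 0]) simp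
  qed (use assms(1) in simp)
  ultimately show ?thesis using ge by (metis INF_greatest)
qed

section \<open>Level sets are rooted subtrees\<close>

lemma mass_level_set_eq:
  "ennreal h \<le> emeasure \<mu> UNIV \<Longrightarrow> mass_level_set \<rho> \<mu> h = {\<sigma>. ennreal h \<le> emeasure \<mu> (up \<sigma>)}"
  unfolding mass_level_set_def using up_root by auto

text \<open>Closedness along a segment has two sources: the last clause of \<open>tame\<close> if
  all masses below y are infinite, and continuity of the measure from above once some mass below y
  is finite.\<close>

lemma rooted_subtree_mass_level_set:
  assumes \<mu>: "tame \<mu>"
  shows "rooted_subtree (mass_level_set \<rho> \<mu> h)"
  unfolding rooted_subtree_def
proof (intro conjI ballI allI impI)
  show "\<rho> \<in> mass_level_set \<rho> \<mu> h" by (simp add: mass_level_set_def)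
next
  fix x w assume "x \<in> mass_level_set \<rho> \<mu> h" "w \<sqsubseteq> x"
  then show "w \<in> mass_level_set \<rho> \<mu> h"
    using emeasure_up_antimono[OF tameD(1)[OF \<mu>], of w x] le_root[of w]
    unfolding mass_level_set_def by auto
next
  fix y assume below: "\<forall>x. x \<sqsubset> y \<longrightarrow> x \<in> mass_level_set \<rho> \<mu> h"
  show "y \<in> mass_level_set \<rho> \<mu> h"
  proof (cases "y = \<rho> \<or> (\<forall>x. x \<sqsubset> y \<longrightarrow> emeasure \<mu> (up x) = \<infinity>)")
    case True
    then have "y = \<rho> \<or> emeasure \<mu> (up y) = \<infinity>" using tameD(5)[OF \<mu>, of y] by blast
    then show ?thesis by (auto simp: mass_level_set_def)
  next
    case False
    then obtain x0 where x0: "x0 \<sqsubset> y" "emeasure \<mu> (up x0) < \<infinity>" "y \<noteq> \<rho>"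
      by (auto simp: less_top)
    have lt: "ht x0 < ht y" using less_ht x0(1) by blast
    \<comment> \<open>Heights that start at \<open>ht x0\<close>, where the mass is already finite,
      and increase strictly to \<open>ht y\<close>.\<close>
    define s where "s n = ht y - (ht y - ht x0) / real (Suc n)" for n
    define x where "x n = pt y (s n)" for n
    have frac: "0 < (ht y - ht x0) / real (Suc n)" "(ht y - ht x0) / real (Suc n) \<le> ht y - ht x0"
      "(ht y - ht x0) / real (Suc (Suc n)) \<le> (ht y - ht x0) / real (Suc n)" for n
      using lt by (auto simp: field_simps intro: mult_left_mono)
    have s: "ht x0 \<le> s n" "s n < ht y" "s n \<le> s (Suc n)" for n
      using frac[of n] by (auto simp: s_def)
    have s0: "0 \<le> s n" for n using s(1) order_trans zero_le_dist by blast
    have hx: "ht (x n) = s n" and xy: "x n \<sqsubseteq> y" for n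
      unfolding x_def using s0 s(2)[of n] ht_pt pt_le by auto
    have xin: "x n \<in> mass_level_set \<rho> \<mu> h" and xne: "x0 \<sqsubseteq> x n" for n
    proof -
      have "x n \<noteq> y" using hx[of n] s(2)[of n] by auto
      then show "x n \<in> mass_level_set \<rho> \<mu> h" using below xy by blast
      show "x0 \<sqsubseteq> x n" using le_below_linear[of x0 y "x n"] x0(1) xy hx s(1) by simp
    qed
    have fin: "emeasure \<mu> (up (x 0)) < \<infinity>"
      using emeasure_up_antimono[OF tameD(1)[OF \<mu>] xne[of 0]] x0(2) by (rule order.strict_trans1)
    \<comment> \<open>The root belongs to the level set by definition, possibly with mass below h.
      If it occurred in the sequence in that way, the next point would be a true member with mass at
      least h, against monotonicity.\<close>
    show ?thesis
    proof (cases "\<exists>n. x n = \<rho> \<and> \<not> ennreal h \<le> emeasure \<mu> (up \<rho>)")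
      case True
      then obtain n where n: "x n = \<rho>" "\<not> ennreal h \<le> emeasure \<mu> (up \<rho>)" by blast
      have "s n < s (Suc n)"
        unfolding s_def using lt by (simp add: frac_less2)
      then have "x (Suc n) \<noteq> \<rho>" using hx[of n] hx[of "Suc n"] n by auto
      then have "ennreal h \<le> emeasure \<mu> (up (x (Suc n)))" using xin[of "Suc n"] by (auto simp: mass_level_set_def)
      also have "\<dots> \<le> emeasure \<mu> (up \<rho>)" by (rule emeasure_up_antimono[OF tameD(1)[OF \<mu>]]) simp
      finally show ?thesis using n by simp
    next
      case False
      then have ge: "ennreal h \<le> emeasure \<mu> (up (x n))" for n
        using xin[of n] unfolding mass_level_set_def by blast
      have mono: "x n \<sqsubseteq> x (Suc n)" for n
        unfolding x_def using s0 s(2)[of "Suc n"] s(3)[of n] by (intro pt_mono) auto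
      have "(\<lambda>n. (ht y - ht x0) * inverse (real (Suc n))) \<longlonglongrightarrow> (ht y - ht x0) * 0"
        by (intro tendsto_mult tendsto_const LIMSEQ_inverse_real_of_nat)
      then have "(\<lambda>n. ht y - (ht y - ht x0) * inverse (real (Suc n))) \<longlonglongrightarrow> ht y - (ht y - ht x0) * 0"
        by (intro tendsto_diff tendsto_const)
      then have lim: "(\<lambda>n. ht (x n)) \<longlonglongrightarrow> ht y" unfolding hx s_def by (simp add: divide_inverse)
      have "ennreal h \<le> emeasure \<mu> (up y)"
        by (rule emeasure_up_limit[OF tameD(1)[OF \<mu>] mono xy lim fin ge])
      then show ?thesis by (simp add: mass_level_set_def)
    qed
  qed
qed

definition max_points :: "'a set \<Rightarrow> 'a set" where
  "max_points D = {x\<in>D. \<forall>y\<in>D. x \<sqsubseteq> y \<longrightarrow> x = y}"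

lemma dirs_empty_iff: "dirs D x = {} \<longleftrightarrow> (\<forall>y\<in>D. x \<sqsubseteq> y \<longrightarrow> x = y)"
  unfolding dirs_def by auto

text \<open>Climbing greedily from \<open>y\<close>, the heights stay bounded because the mass above \<open>y\<close> is finite,
  so the climb converges by completeness.\<close>

lemma ex_max_point_above:
  assumes \<mu>: "sets \<mu> = sets borel" and h: "0 < h"
    and y: "emeasure \<mu> (up y) < \<infinity>" "ennreal h \<le> emeasure \<mu> (up y)"
  defines "D \<equiv> {\<sigma>. ennreal h \<le> emeasure \<mu> (up \<sigma>)}"
  shows "\<exists>z\<in>max_points D. y \<sqsubseteq> z"
proof -
  have sp: "space \<mu> = UNIV" using sets_eq_imp_space_eq[OF \<mu>] by simp
  obtain B where B: "\<And>z. z \<in> D \<Longrightarrow> y \<sqsubseteq> z \<Longrightarrow> ht z \<le> B"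
  proof -
    \<comment> \<open>The mass above y beyond height n tends to 0, so it drops below h for some n; a
      point of D at greater height would need mass h there.\<close>
    define A where "A n = {w\<in>up y. real n \<le> ht w}" for n
    have "closed (A n)" for n
    proof -
      have "closed {w. real n \<le> ht w}" by (intro closed_Collect_le continuous_intros)
      then have "closed (up y \<inter> {w. real n \<le> ht w})" using closed_up by blast
      then show ?thesis by (simp add: A_def Int_def)
    qed
    then have As: "A n \<in> sets \<mu>" for n by (simp add: \<mu> borel_closed)
    have dec: "decseq A" by (rule decseq_SucI) (auto simp: A_def)
    have A0: "emeasure \<mu> (A 0) \<noteq> \<infinity>"
    proof -
      have "A 0 = up y" by (auto simp: A_def)
      then show ?thesis using y(1) by simp
    qed
    have "(\<Inter>n. A n) = {}"
    proof -
      have False if "\<forall>n. real n \<le> ht w" for w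
        using that reals_Archimedean2[of "ht w"] by (meson not_less)
      then show ?thesis by (auto simp: A_def)
    qed
    then have INF0: "(INF n. emeasure \<mu> (A n)) = 0"
      using INF_emeasure_decseq'[OF As dec] A0 by (metis emeasure_empty)
    have "\<exists>n. emeasure \<mu> (A n) < ennreal h"
    proof (rule ccontr)
      assume "\<not> ?thesis"
      then have "ennreal h \<le> (INF n. emeasure \<mu> (A n))" by (intro INF_greatest) (simp add: not_less)
      then show False using INF0 h by simp
    qed
    then obtain n where n: "emeasure \<mu> (A n) < ennreal h" by blast
    show thesis
    proof (rule that[of "real n"])
      fix z assume z: "z \<in> D" "y \<sqsubseteq> z"
      show "ht z \<le> real n"
      proof (rule ccontr)
        assume "\<not> ?thesis"
        then have "up z \<subseteq> A n" using le_trans[OF z(2)] le_ht[of z] by (fastforce simp: A_def)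
        then have "emeasure \<mu> (up z) \<le> emeasure \<mu> (A n)" by (rule emeasure_mono[OF _ As])
        then show False using n z(1) by (simp add: D_def)
      qed
    qed
  qed
  define s where "s x = Sup (ht ` {z\<in>D. x \<sqsubseteq> z})" for x
  have bdd: "bdd_above (ht ` {z\<in>D. x \<sqsubseteq> z})" if "y \<sqsubseteq> x" for x
    by (rule bdd_aboveI[of _ B]) (use B le_trans[OF that] in blast)
  have s_ub: "ht z \<le> s x" if "y \<sqsubseteq> x" "z \<in> D" "x \<sqsubseteq> z" for x z
    unfolding s_def by (rule cSup_upper[OF _ bdd[OF that(1)]]) (use that in blast)
  have s_approx: "\<exists>z\<in>D. x \<sqsubseteq> z \<and> s x - e < ht z" if "x \<in> D" "y \<sqsubseteq> x" "0 < e" for x e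
  proof -
    have "s x - e < Sup (ht ` {z\<in>D. x \<sqsubseteq> z})" using that(3) by (simp add: s_def)
    moreover have "ht ` {z\<in>D. x \<sqsubseteq> z} \<noteq> {}" using that(1) le_refl by blast
    ultimately have "\<exists>t\<in>ht ` {z\<in>D. x \<sqsubseteq> z}. s x - e < t"
      using less_cSup_iff[OF _ bdd[OF that(2)]] by blast
    then show ?thesis by blast
  qed
  \<comment> \<open>Step n comes within 1/(n+1) of the supremum of the heights still reachable in D.
    This error tends to 0, which later makes the limit maximal.\<close>
  have "\<exists>x. \<forall>n. (x n \<in> D \<and> y \<sqsubseteq> x n) \<and> (x n \<sqsubseteq> x (Suc n) \<and> s (x n) - inverse (real (Suc n)) < ht (x (Suc n)))"
  proof (rule dependent_nat_choice)
    show "\<exists>x. x \<in> D \<and> y \<sqsubseteq> x" using y(2) by (intro exI[of _ y]) (simp add: D_def)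
    fix x n assume x: "x \<in> D \<and> y \<sqsubseteq> x"
    then obtain z where "z \<in> D" "x \<sqsubseteq> z" "s x - inverse (real (Suc n)) < ht z"
      using s_approx[of x "inverse (real (Suc n))"] by auto
    then show "\<exists>z. (z \<in> D \<and> y \<sqsubseteq> z) \<and> (x \<sqsubseteq> z \<and> s x - inverse (real (Suc n)) < ht z)"
      using x le_trans by blast
  qed
  then obtain x where x: "\<And>n. x n \<in> D" "\<And>n. y \<sqsubseteq> x n" "\<And>n. x n \<sqsubseteq> x (Suc n)"
    "\<And>n. s (x n) - inverse (real (Suc n)) < ht (x (Suc n))" by blast
  have xmono: "x m \<sqsubseteq> x n" if "m \<le> n" for m n
    using that by (induction rule: dec_induct) (rule le_refl, erule le_trans[OF _ x(3)])
  have inc: "incseq (\<lambda>n. ht (x n))" by (intro incseq_SucI le_ht x(3))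
  have "\<forall>n. ht (x n) \<le> B" by (intro allI B x(1,2))
  from incseq_convergent[OF inc this] obtain L where "(\<lambda>n. ht (x n)) \<longlonglongrightarrow> L" .
  then have "convergent (\<lambda>n. ht (x n))" by (rule convergentI)
  then have "Cauchy (\<lambda>n. ht (x n))" by (rule convergent_Cauchy)
  \<comment> \<open>Along a chain distances are differences of heights, so convergence of the
    heights makes the chain a Cauchy sequence.\<close>
  moreover have "dist (x m) (x n) = dist (ht (x m)) (ht (x n))" for m n
  proof (cases "m \<le> n")
    case True
    then show ?thesis using dist_le[OF xmono[OF True]] le_ht[OF xmono[OF True]] by (simp add: dist_real_def)
  next
    case False
    then have "n \<le> m" by simp
    then show ?thesis using dist_le[OF xmono[of n m]] le_ht[OF xmono[of n m]]
      by (simp add: dist_real_def dist_commute)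
  qed
  ultimately have "Cauchy x" unfolding Cauchy_def by simp
  then obtain z where z: "x \<longlonglongrightarrow> z" using Cauchy_convergent convergent_def by blast
  have xz: "x n \<sqsubseteq> z" for n
  proof -
    have "eventually (\<lambda>k. x k \<in> up (x n)) sequentially"
      using eventually_ge_at_top[of n] by eventually_elim (simp add: xmono)
    then have "z \<in> up (x n)"
      by (rule Lim_in_closed_set[OF closed_up _ _ z]) simp
    then show ?thesis by simp
  qed
  have lim: "(\<lambda>n. ht (x n)) \<longlonglongrightarrow> ht z" by (intro tendsto_intros z)
  have fin: "emeasure \<mu> (up (x 0)) < \<infinity>"
    using emeasure_up_antimono[OF \<mu> x(2)[of 0]] y(1) by (rule order.strict_trans1)
  have "ennreal h \<le> emeasure \<mu> (up z)"
    by (rule emeasure_up_limit[OF \<mu> x(3) xz lim fin]) (use x(1) in \<open>simp add: D_def\<close>)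
  then have zD: "z \<in> D" by (simp add: D_def)
  have "z = w" if w: "w \<in> D" "z \<sqsubseteq> w" for w
  proof (rule le_eq_ht[OF w(2)])
    have "ht w \<le> ht z + inverse (real (Suc n))" for n
      using s_ub[OF x(2)[of n] w(1)] le_trans[OF xz w(2)] x(4)[of n] le_ht[OF xz[of "Suc n"]] by fastforce
    moreover have "(\<lambda>n. ht z + inverse (real (Suc n))) \<longlonglongrightarrow> ht z + 0"
      by (intro tendsto_add tendsto_const LIMSEQ_inverse_real_of_nat)
    ultimately show "ht w \<le> ht z" by (intro LIMSEQ_le_const[of _ "ht z"]) auto
  qed
  then have "z \<in> max_points D" using zD by (auto simp: max_points_def)
  moreover have "y \<sqsubseteq> z" using le_trans[OF x(2) xz] .
  ultimately show ?thesis by blast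
qed

end

section \<open>The erased measure\<close>

lemma infsum_ennreal_eq_SUP:
  fixes f :: "'a \<Rightarrow> ennreal"
  shows "infsum f X = (SUP F\<in>{F. finite F \<and> F \<subseteq> X}. sum f F)"
  by (rule nonneg_infsum_complete) simp

lemma summable_on_ennreal:
  fixes f :: "'a \<Rightarrow> ennreal"
  shows "f summable_on X"
  by (rule nonneg_summable_on_complete) simp

lemma sum_le_infsum_ennreal:
  fixes f :: "'a \<Rightarrow> ennreal"
  shows "finite F \<Longrightarrow> F \<subseteq> X \<Longrightarrow> sum f F \<le> infsum f X"
  unfolding infsum_ennreal_eq_SUP by (rule SUP_upper) simp

lemma infsum_ennreal_supported:
  fixes f :: "'a \<Rightarrow> ennreal"
  assumes "finite F" "\<And>x. x \<in> X - F \<Longrightarrow> f x = 0" "\<And>x. x \<in> F - X \<Longrightarrow> g x = 0"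
    "\<And>x. x \<in> F \<inter> X \<Longrightarrow> f x = g x"
  shows "infsum f X = sum g F"
proof -
  have "infsum f X = infsum g F"
    by (rule infsum_cong_neutral) (use assms in auto)
  then show ?thesis using assms(1) by simp
qed

lemma finite_if_infsum_finite:
  fixes f :: "'a \<Rightarrow> ennreal"
  assumes "infsum f X < \<infinity>" "\<And>x. x \<in> X \<Longrightarrow> 1 \<le> f x"
  shows "finite X"
proof (rule ccontr)
  assume "infinite X"
  have "of_nat n \<le> infsum f X" for n
  proof -
    obtain F where F: "finite F" "F \<subseteq> X" "card F = n"
      using infinite_arbitrarily_large[OF \<open>infinite X\<close>] by metis
    have "of_nat n = (\<Sum>x\<in>F. 1 :: ennreal)" using F by simp
    also have "\<dots> \<le> sum f F" using assms(2) F by (intro sum_mono) auto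
    also have "\<dots> \<le> infsum f X" by (rule sum_le_infsum_ennreal[OF F(1,2)])
    finally show ?thesis .
  qed
  then show False using assms(1) ennreal_Ex_less_of_nat[of "infsum f X"] by (auto simp: not_less[symmetric])
qed

lemma infsum_singleton_ennreal:
  fixes f :: "'a \<Rightarrow> ennreal"
  shows "infsum f {x} = f x"
  by simp

text \<open>Countable additivity of a sum of weighted point masses. X may be uncountable; each
  inequality follows by truncating one of the two sums to a finite one.\<close>

lemma suminf_infsum_indicator:
  fixes g :: "'a \<Rightarrow> ennreal"
  assumes A: "disjoint_family A"
  shows "(\<Sum>i. \<Sum>\<^sub>\<infinity>x\<in>X. g x * indicator (A i) x) = (\<Sum>\<^sub>\<infinity>x\<in>X. g x * indicator (\<Union>i. A i) x)"
proof (rule antisym)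
  have "(\<Sum>i<n. \<Sum>\<^sub>\<infinity>x\<in>X. g x * indicator (A i) x) \<le> (\<Sum>\<^sub>\<infinity>x\<in>X. g x * indicator (\<Union>i. A i) x)" for n
  proof -
    have "(\<Sum>i<n. \<Sum>\<^sub>\<infinity>x\<in>X. g x * indicator (A i) x) = (\<Sum>\<^sub>\<infinity>x\<in>X. \<Sum>i<n. g x * indicator (A i) x)"
    proof (induction n)
      case (Suc n)
      have "(\<Sum>\<^sub>\<infinity>x\<in>X. (\<Sum>i<n. g x * indicator (A i) x) + g x * indicator (A n) x) =
          (\<Sum>\<^sub>\<infinity>x\<in>X. \<Sum>i<n. g x * indicator (A i) x) + (\<Sum>\<^sub>\<infinity>x\<in>X. g x * indicator (A n) x)"
        by (intro infsum_add summable_on_ennreal)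
      then show ?case using Suc by (simp only: sum.lessThan_Suc)
    qed simp
    also have "\<dots> \<le> (\<Sum>\<^sub>\<infinity>x\<in>X. g x * indicator (\<Union>i. A i) x)"
    proof (rule infsum_mono)
      fix x
      have "(\<Sum>i<n. indicator (A i) x) \<le> (\<Sum>i. indicator (A i) x :: ennreal)"
        by (rule sum_le_suminf) auto
      then show "(\<Sum>i<n. g x * indicator (A i) x) \<le> g x * indicator (\<Union>i. A i) x"
        unfolding suminf_indicator[OF A] sum_distrib_left[symmetric] by (rule mult_left_mono) simp
    qed (rule summable_on_ennreal)+
    finally show ?thesis .
  qed
  then show "(\<Sum>i. \<Sum>\<^sub>\<infinity>x\<in>X. g x * indicator (A i) x) \<le> (\<Sum>\<^sub>\<infinity>x\<in>X. g x * indicator (\<Union>i. A i) x)"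
    by (intro suminf_le_const) auto
next
  have "(\<Sum>x\<in>F. g x * indicator (\<Union>i. A i) x) \<le> (\<Sum>i. \<Sum>\<^sub>\<infinity>x\<in>X. g x * indicator (A i) x)"
    if F: "finite F" "F \<subseteq> X" for F
  proof -
    have "(\<Sum>x\<in>F. g x * indicator (\<Union>i. A i) x) = (\<Sum>x\<in>F. \<Sum>i. g x * indicator (A i) x)"
      unfolding suminf_indicator[OF A, symmetric] by simp
    also have "\<dots> = (\<Sum>i. \<Sum>x\<in>F. g x * indicator (A i) x)"
      by (rule suminf_sum[symmetric]) simp
    also have "\<dots> \<le> (\<Sum>i. \<Sum>\<^sub>\<infinity>x\<in>X. g x * indicator (A i) x)"
      by (intro suminf_le sum_le_infsum_ennreal[OF F]) auto
    finally show ?thesis .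
  qed
  then show "(\<Sum>\<^sub>\<infinity>x\<in>X. g x * indicator (\<Union>i. A i) x) \<le> (\<Sum>i. \<Sum>\<^sub>\<infinity>x\<in>X. g x * indicator (A i) x)"
    unfolding infsum_ennreal_eq_SUP[of "\<lambda>x. g x * indicator (\<Union>i. A i) x"] by (intro SUP_least) auto
qed

context rooted_real_tree
begin

text \<open>The branching excess is \<open>n(\<tau>) - 2\<close> off the root and \<open>n(\<rho>) - 1\<close> at the root, truncated at
  \<open>0\<close>. The truncation at leaves is why \<open>erasure_fun\<close> treats the maximal points separately; these
  include the root if it is the only point.\<close>

definition excess :: "'a set \<Rightarrow> 'a \<Rightarrow> ennreal" where
  "excess D \<tau> = (if finite (dirs D \<tau>) then of_nat (card (dirs D \<tau>) - 1) else \<infinity>)"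

text \<open>The point mass subtracted at the root is absorbed here into the other terms, so the set
  function is a sum of nonnegative terms and its countable additivity can be checked term by
  term.\<close>

definition erasure_fun :: "real \<Rightarrow> 'a measure \<Rightarrow> 'a set \<Rightarrow> ennreal" where
  "erasure_fun h \<mu> A = (let R = mass_level_set \<rho> \<mu> h in
     emeasure (Pr \<rho> R \<mu>) (A \<inter> (R - max_points R))
     + (\<Sum>\<^sub>\<infinity>\<sigma>\<in>max_points R. (emeasure \<mu> (up \<sigma>) - ennreal h) * indicator A \<sigma>)
     + ennreal h * (\<Sum>\<^sub>\<infinity>\<sigma>\<in>R. excess R \<sigma> * indicator A \<sigma>))"

section \<open>The erasure formula in terms of directions\<close>

lemma degree_rooted_subtree:
  assumes "rooted_subtree D" "\<tau> \<in> D"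
  shows "degree \<tau> D = (if finite (dirs D \<tau>) then enat (card (dirs D \<tau>) + (if \<tau> = \<rho> then 0 else 1)) else \<infinity>)"
  by (rule degree_eq) (use assms rooted_subtreeD(2) in blast)+

lemma max_points_eq: "max_points D = {x\<in>D. dirs D x = {}}"
  unfolding max_points_def dirs_empty_iff ..

lemma leaves_eq:
  assumes D: "rooted_subtree D"
  shows "leaves \<rho> D = max_points D - {\<rho>}"
proof -
  have "degree \<sigma> D = 1 \<longleftrightarrow> dirs D \<sigma> = {}" if "\<sigma> \<in> D" "\<sigma> \<noteq> \<rho>" for \<sigma>
    using degree_rooted_subtree[OF D that(1)] that(2) by (auto simp: one_enat_def)
  then show ?thesis unfolding leaves_def max_points_eq by auto
qed

text \<open>Off the root the degree is the number of directions plus one, so taking 2 from it takes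
  1 from the directions. Infinite values stay infinite on both sides.\<close>

lemma excess_branch_point:
  assumes D: "rooted_subtree D" and "\<sigma> \<in> D" "\<sigma> \<noteq> \<rho>"
  shows "\<sigma> \<in> branch_points \<rho> D \<Longrightarrow> ennreal_of_enat (degree \<sigma> D) - 2 = excess D \<sigma>"
    and "\<sigma> \<notin> branch_points \<rho> D \<Longrightarrow> excess D \<sigma> = 0"
proof -
  have deg: "degree \<sigma> D = (if finite (dirs D \<sigma>) then enat (card (dirs D \<sigma>) + 1) else \<infinity>)"
    using degree_rooted_subtree[OF D assms(2)] assms(3) by simp
  have bp: "\<sigma> \<in> branch_points \<rho> D \<longleftrightarrow> (finite (dirs D \<sigma>) \<longrightarrow> 2 \<le> card (dirs D \<sigma>))"
    unfolding branch_points_def using assms(2,3) by (auto simp: deg numeral_eq_enat)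
  show "ennreal_of_enat (degree \<sigma> D) - 2 = excess D \<sigma>" if \<sigma>: "\<sigma> \<in> branch_points \<rho> D"
  proof (cases "finite (dirs D \<sigma>)")
    case True
    then obtain n where n: "card (dirs D \<sigma>) = Suc n" "1 \<le> n" using \<sigma> True unfolding bp by (cases "card (dirs D \<sigma>)") auto
    have "(of_nat (Suc n + 1) :: ennreal) = of_nat n + 2" by (simp add: add_ac)
    then have "(of_nat (Suc n + 1) :: ennreal) - 2 = of_nat n" by (simp only: ennreal_add_diff_cancel_right) simp
    then show ?thesis using True n(1) by (simp only: deg excess_def if_True ennreal_of_enat_enat diff_Suc_1)
  next
    case False
    then show ?thesis by (simp add: deg excess_def)
  qed
  show "excess D \<sigma> = 0" if "\<sigma> \<notin> branch_points \<rho> D"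
    using that bp by (auto simp: excess_def)
qed

lemma infsum_excess:
  assumes D: "rooted_subtree D"
  shows "(\<Sum>\<^sub>\<infinity>\<sigma>\<in>D. excess D \<sigma> * indicator A \<sigma>) = excess D \<rho> * indicator A \<rho> +
     (\<Sum>\<^sub>\<infinity>\<sigma>\<in>branch_points \<rho> D. (ennreal_of_enat (degree \<sigma> D) - 2) * indicator A \<sigma>)"
proof -
  let ?B = "branch_points \<rho> D"
  have sub: "?B \<subseteq> D - {\<rho>}" by (auto simp: branch_points_def)
  have "(\<Sum>\<^sub>\<infinity>\<sigma>\<in>D. excess D \<sigma> * indicator A \<sigma>) = (\<Sum>\<^sub>\<infinity>\<sigma>\<in>{\<rho>} \<union> ?B. excess D \<sigma> * indicator A \<sigma>)"
    by (rule infsum_cong_neutral) (use sub rooted_subtreeD(1)[OF D] excess_branch_point(2)[OF D] in auto)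
  also have "\<dots> = (\<Sum>\<^sub>\<infinity>\<sigma>\<in>{\<rho>}. excess D \<sigma> * indicator A \<sigma>) + (\<Sum>\<^sub>\<infinity>\<sigma>\<in>?B. excess D \<sigma> * indicator A \<sigma>)"
    by (intro infsum_Un_disjoint summable_on_ennreal) (use sub in auto)
  also have "(\<Sum>\<^sub>\<infinity>\<sigma>\<in>?B. excess D \<sigma> * indicator A \<sigma>) =
      (\<Sum>\<^sub>\<infinity>\<sigma>\<in>?B. (ennreal_of_enat (degree \<sigma> D) - 2) * indicator A \<sigma>)"
  proof (rule infsum_cong)
    fix x assume x: "x \<in> ?B"
    then have "x \<in> D" "x \<noteq> \<rho>" using sub by auto
    then show "excess D x * indicator A x = (ennreal_of_enat (degree x D) - 2) * indicator A x"
      using excess_branch_point(1)[OF D _ _ x] by simp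
  qed
  finally show ?thesis unfolding infsum_singleton_ennreal .
qed

lemma Pr_emeasure:
  assumes "sets \<mu> = sets borel" "rooted_subtree D" "A \<in> sets borel"
  shows "emeasure (Pr \<rho> D \<mu>) A = emeasure \<mu> (tree_proj \<rho> D -` A)"
proof -
  have "tree_proj \<rho> D \<in> \<mu> \<rightarrow>\<^sub>M borel"
    using tree_proj_measurable[OF assms(2)] measurable_cong_sets[OF assms(1) refl] by blast
  then show ?thesis
    unfolding Pr_def using emeasure_distr[of "tree_proj \<rho> D" \<mu> borel A] assms(3)
      sets_eq_imp_space_eq[OF assms(1)] by simp
qed

text \<open>The two set functions agree on every set. If R has more than the root, the degree of the
  root is its excess plus one, and the surplus h cancels the subtracted point mass.\<close>

lemma mass_erasure_eq:
  assumes \<mu>: "tame \<mu>" and h: "0 < h" and ge: "ennreal h \<le> emeasure \<mu> UNIV"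
  shows "mass_erasure \<rho> h \<mu> = measure_of UNIV (sets borel) (erasure_fun h \<mu>)"
proof -
  define R where "R = mass_level_set \<rho> \<mu> h"
  have R: "rooted_subtree R" unfolding R_def by (rule rooted_subtree_mass_level_set[OF \<mu>])
  have \<rho>R: "\<rho> \<in> R" by (rule rooted_subtreeD(1)[OF R])
  let ?P = "\<lambda>A. emeasure (Pr \<rho> R \<mu>) A"
  let ?L = "\<lambda>A \<sigma>. (emeasure \<mu> (up \<sigma>) - ennreal h) * indicator A \<sigma>"
  let ?B = "\<lambda>A. \<Sum>\<^sub>\<infinity>\<sigma>\<in>branch_points \<rho> R. (ennreal_of_enat (degree \<sigma> R) - 2) * indicator A \<sigma>"
  have "?P (A \<inter> (R - leaves \<rho> R)) + (\<Sum>\<^sub>\<infinity>\<sigma>\<in>leaves \<rho> R. ?L A \<sigma>)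
        + ennreal h * ennreal_of_enat (degree \<rho> R) * indicator A \<rho>
        + ennreal h * ?B A - ennreal h * indicator A \<rho> = erasure_fun h \<mu> A" for A
  \<comment> \<open>If R is just the root, the root is a maximal point but not a leaf: the
    definition projects the whole mass there and subtracts h, while \<open>erasure_fun\<close> does
    so in its second term.\<close>
  proof (cases "R = {\<rho>}")
    case True
    have d: "dirs R \<rho> = {}" unfolding dirs_empty_iff True by simp
    have mx: "max_points R = {\<rho>}" unfolding max_points_def True by auto
    have lv: "leaves \<rho> R = {}" unfolding leaves_eq[OF R] mx by simp
    have deg: "degree \<rho> R = 0" using degree_rooted_subtree[OF R \<rho>R] d by (simp add: zero_enat_def)
    have bp: "branch_points \<rho> R = {}" unfolding branch_points_def True by auto
    have exc: "excess R \<rho> = 0" using d by (simp add: excess_def)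
    have "tree_proj \<rho> R y = \<rho>" for y using tree_proj_mem[OF R] True by auto
    then have "?P {\<rho>} = emeasure \<mu> UNIV"
      using Pr_emeasure[OF tameD(1)[OF \<mu>] R, of "{\<rho>}"] by (simp add: vimage_def)
    then have "?P (A \<inter> {\<rho>}) = emeasure \<mu> UNIV * indicator A \<rho>"
      by (cases "\<rho> \<in> A") auto
    then show ?thesis
      unfolding erasure_fun_def Let_def R_def[symmetric] mx lv bp deg infsum_excess[OF R] infsum_singleton_ennreal
      using exc unfolding True by (simp split: split_indicator)
  next
    case False
    then obtain y where "y \<in> R" "y \<noteq> \<rho>" using \<rho>R by auto
    then have d: "dirs R \<rho> \<noteq> {}" unfolding dirs_empty_iff using root_le[of y] by auto
    then have lv: "leaves \<rho> R = max_points R" unfolding leaves_eq[OF R] max_points_eq by auto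
    have deg: "ennreal_of_enat (degree \<rho> R) = excess R \<rho> + 1"
    proof (cases "finite (dirs R \<rho>)")
      case True
      then obtain n where "card (dirs R \<rho>) = Suc n" using d by (cases "card (dirs R \<rho>)") auto
      then show ?thesis using degree_rooted_subtree[OF R \<rho>R] True by (simp add: excess_def add_ac)
    next
      case False
      then show ?thesis using degree_rooted_subtree[OF R \<rho>R] by (simp add: excess_def)
    qed
    show ?thesis
    proof (cases "\<rho> \<in> A")
      case True
      have "x + y + ennreal h * (e + 1) + z - ennreal h = x + y + (ennreal h * e + z)" for x y e z
      proof -
        have "x + y + ennreal h * (e + 1) + z = x + y + (ennreal h * e + z) + ennreal h"
          unfolding distrib_left by (simp add: add_ac)
        then show ?thesis by (simp only: ennreal_add_diff_cancel_right) simp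
      qed
      then show ?thesis
        unfolding erasure_fun_def Let_def R_def[symmetric] lv deg infsum_excess[OF R]
        using True by (simp add: distrib_left)
    next
      case False
      then show ?thesis
        unfolding erasure_fun_def Let_def R_def[symmetric] lv infsum_excess[OF R] by simp
    qed
  qed
  then show ?thesis
    unfolding mass_erasure_def Let_def R_def[symmetric] using h ge by (simp add: not_less[symmetric])
qed

end

text \<open>The regime in which erasure is given by the long formula. By \<open>h_le\<close> the
  root satisfies the mass condition itself, so R is a plain superlevel set.\<close>

locale level_set = rooted_real_tree +
  fixes \<mu> :: "'a measure" and h :: real
  assumes tame: "tame \<mu>" and h_pos: "0 < h" and h_le: "ennreal h \<le> emeasure \<mu> UNIV"
begin

section \<open>Maximal points of the level set, and countable additivity\<close>

abbreviation R :: "'a set" where "R \<equiv> mass_level_set \<rho> \<mu> h"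

lemmas sets_\<mu> = tameD(1)[OF tame] and space_\<mu> = tameD(2)[OF tame]

lemma up_sets: "up ` G \<subseteq> sets \<mu>"
  using up_borel sets_\<mu> by (simp add: image_subset_iff)

lemma R_eq: "R = {\<sigma>. ennreal h \<le> emeasure \<mu> (up \<sigma>)}"
  by (rule mass_level_set_eq[OF h_le])

lemma rooted_subtree_R: "rooted_subtree R"
  by (rule rooted_subtree_mass_level_set[OF tame])

lemma R_down: "x \<in> R \<Longrightarrow> w \<sqsubseteq> x \<Longrightarrow> w \<in> R"
  by (rule rooted_subtreeD(2)[OF rooted_subtree_R])

lemma top_points_subset_R: "top_points \<mu> r \<subseteq> R"
  unfolding R_eq top_points_def by auto

lemma max_point_up_subset_trunk:
  assumes l: "l \<in> max_points R" "l \<in> trunk \<mu> r"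
  shows "up l \<subseteq> trunk \<mu> r"
proof (rule up_subset_trunk[OF l(2)])
  fix e assume e: "e \<in> top_points \<mu> r"
  show "\<not> l \<sqsubseteq> e"
  proof
    assume "l \<sqsubseteq> e"
    then have "l = e" using l(1) e top_points_subset_R unfolding max_points_def by blast
    then show False using l(2) e unfolding trunk_def by auto
  qed
qed

lemma max_points_incomparable: "l \<in> max_points R \<Longrightarrow> l' \<in> R \<Longrightarrow> l \<sqsubseteq> l' \<Longrightarrow> l = l'"
  by (auto simp: max_points_def)

lemma max_points_disjoint: "disjoint_family_on up (max_points R)"
  unfolding disjoint_family_on_def
proof (intro ballI impI)
  fix l l' assume l: "l \<in> max_points R" "l' \<in> max_points R" "l \<noteq> l'"
  then have "l \<in> R" "l' \<in> R" by (auto simp: max_points_def)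
  then show "up l \<inter> up l' = {}"
    using max_points_incomparable[OF l(1)] max_points_incomparable[OF l(2)] l(3) up_disjoint_or_le[of l l'] by metis
qed

text \<open>Up-sets of maximal points are disjoint, have mass at least h and stay inside the trunk,
  whose mass is finite.\<close>

lemma finite_max_points_trunk:
  assumes r: "0 < r"
  shows "finite (max_points R \<inter> trunk \<mu> r)"
proof (rule ccontr)
  assume inf: "infinite (max_points R \<inter> trunk \<mu> r)"
  have tr: "trunk \<mu> r \<in> sets \<mu>"
    using trunk_borel[OF tameD(3)[OF tame r]] sets_\<mu> by simp
  have "of_nat n * ennreal h \<le> emeasure \<mu> (trunk \<mu> r)" for n
  proof -
    obtain G where G: "finite G" "G \<subseteq> max_points R \<inter> trunk \<mu> r" "card G = n"
      using infinite_arbitrarily_large[OF inf] by metis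
    have dis: "disjoint_family_on up G"
      using max_points_disjoint G(2) by (meson disjoint_family_on_mono le_inf_iff)
    have "of_nat n * ennreal h = (\<Sum>l\<in>G. ennreal h)" using G by simp
    also have "\<dots> \<le> (\<Sum>l\<in>G. emeasure \<mu> (up l))"
      using G(2) by (intro sum_mono) (auto simp: max_points_def R_eq)
    also have "\<dots> = emeasure \<mu> (\<Union>l\<in>G. up l)"
      by (rule sum_emeasure[OF up_sets dis G(1)])
    also have "\<dots> \<le> emeasure \<mu> (trunk \<mu> r)"
      using G(2) max_point_up_subset_trunk by (intro emeasure_mono[OF _ tr]) blast
    finally show ?thesis .
  qed
  moreover have "\<exists>n. emeasure \<mu> (trunk \<mu> r) < of_nat n * ennreal h"
  proof -
    have "emeasure \<mu> (trunk \<mu> r) / ennreal h < \<infinity>"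
      using tameD(4)[OF tame r] h_pos by (simp add: ennreal_divide_eq_top_iff less_top[symmetric])
    then obtain n where "emeasure \<mu> (trunk \<mu> r) / ennreal h < of_nat n"
      using ennreal_Ex_less_of_nat by auto
    then show ?thesis
      using h_pos by (intro exI[of _ n]) (simp add: divide_less_ennreal)
  qed
  ultimately show False by (auto simp: not_less[symmetric])
qed

lemma countable_max_points: "countable (max_points R)"
proof (rule countable_subset)
  show "max_points R \<subseteq> (\<Union>n. max_points R \<inter> trunk \<mu> (real (Suc n)))"
  proof
    fix l assume "l \<in> max_points R"
    moreover obtain n where "ht l < real n" using reals_Archimedean2 by blast
    then have "l \<in> trunk \<mu> (real (Suc n))" by (intro mem_trunk) simp
    ultimately show "l \<in> (\<Union>n. max_points R \<inter> trunk \<mu> (real (Suc n)))" by blast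
  qed
  show "countable (\<Union>n. max_points R \<inter> trunk \<mu> (real (Suc n)))"
    by (rule countable_UN[OF countableI_type], rule countable_finite, rule finite_max_points_trunk) simp
qed

lemma core_borel: "R - max_points R \<in> sets borel"
proof -
  have "max_points R \<in> sets borel"
    by (rule sets.countable[OF _ countable_max_points]) (rule borel_closed[OF closed_singleton])
  then show ?thesis by (rule sets.Diff[OF rooted_subtree_borel[OF rooted_subtree_R]])
qed

text \<open>\<open>measure_of\<close> yields the zero measure unless the given set function is a
  measure, so countable additivity has to come first.\<close>

lemma emeasure_mass_erasure:
  assumes "A \<in> sets borel"
  shows "emeasure (mass_erasure \<rho> h \<mu>) A = erasure_fun h \<mu> A"
  unfolding mass_erasure_eq[OF tame h_pos h_le]
proof (rule emeasure_measure_of_sigma[OF _ _ _ assms])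
  show "sigma_algebra UNIV (sets (borel :: 'a measure))"
    using sets.sigma_algebra_axioms[of "borel :: 'a measure"] by simp
  show "positive (sets borel) (erasure_fun h \<mu>)"
    by (simp add: positive_def erasure_fun_def Let_def)
  show "countably_additive (sets borel) (erasure_fun h \<mu>)"
    unfolding countably_additive_def
  proof (intro allI impI)
    fix A :: "nat \<Rightarrow> 'a set"
    assume A: "range A \<subseteq> sets borel" and dis: "disjoint_family A"
    let ?K = "R - max_points R"
    have "(\<Sum>i. emeasure (Pr \<rho> R \<mu>) (A i \<inter> ?K)) = emeasure (Pr \<rho> R \<mu>) (\<Union>i. A i \<inter> ?K)"
    proof (rule suminf_emeasure)
      show "range (\<lambda>i. A i \<inter> ?K) \<subseteq> sets (Pr \<rho> R \<mu>)"
        using A core_borel by (auto simp: Pr_def)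
      show "disjoint_family (\<lambda>i. A i \<inter> ?K)"
        using dis by (auto simp: disjoint_family_on_def)
    qed
    then have 1: "(\<Sum>i. emeasure (Pr \<rho> R \<mu>) (A i \<inter> ?K)) = emeasure (Pr \<rho> R \<mu>) ((\<Union>i. A i) \<inter> ?K)"
      by simp
    show "(\<Sum>i. erasure_fun h \<mu> (A i)) = erasure_fun h \<mu> (\<Union>(range A))"
      unfolding erasure_fun_def Let_def
      by (simp only: suminf_add[symmetric] summableI ennreal_suminf_cmult 1 suminf_infsum_indicator[OF dis])
  qed
qed

lemma sets_mass_erasure: "sets (mass_erasure \<rho> h \<mu>) = sets borel"
proof -
  have "sets (mass_erasure \<rho> h \<mu>) = sigma_sets UNIV (sets borel)"
    unfolding mass_erasure_eq[OF tame h_pos h_le] by (rule sets_measure_of) simp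
  also have "\<dots> = sets borel"
    using sets.sigma_sets_eq[of "borel :: 'a measure"] by simp
  finally show ?thesis .
qed

section \<open>Ends: the tips of the level set after cutting\<close>

definition ends :: "real \<Rightarrow> 'a set" where
  "ends r = (max_points R \<inter> trunk \<mu> r) \<union> top_points \<mu> r"

lemma ends_subset_R: "ends r \<subseteq> R"
  unfolding ends_def using top_points_subset_R by (auto simp: max_points_def)

lemma finite_ends: "0 < r \<Longrightarrow> finite (ends r)"
  unfolding ends_def using finite_max_points_trunk tameD(3)[OF tame] by simp

lemma ends_antichain:
  assumes "f \<in> ends r" "g \<in> ends r" "f \<sqsubseteq> g"
  shows "f = g"
proof (cases "f \<in> max_points R")
  case True
  then show ?thesis using max_points_incomparable assms(2,3) ends_subset_R by blast
next
  case False
  then have f: "f \<in> top_points \<mu> r" using assms(1) by (auto simp: ends_def)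
  then have "g \<notin> trunk \<mu> r" using assms(3) by (auto simp: trunk_def)
  then have "g \<in> top_points \<mu> r" using assms(2) by (auto simp: ends_def)
  then show ?thesis using top_points_antichain[OF f] assms(3) by simp
qed

text \<open>If no cut point is above y, then \<open>up y\<close> stays in the trunk and has finite
  mass, so one can climb to a maximal point.\<close>

lemma ex_end_above:
  assumes y: "y \<in> R" "y \<in> trunk \<mu> r" and r: "0 < r"
  shows "\<exists>f\<in>ends r. y \<sqsubseteq> f"
proof (cases "\<exists>e\<in>top_points \<mu> r. y \<sqsubseteq> e")
  case True
  then show ?thesis by (auto simp: ends_def)
next
  case False
  then have sub: "up y \<subseteq> trunk \<mu> r" using up_subset_trunk[OF y(2)] by blast
  have "emeasure \<mu> (up y) \<le> emeasure \<mu> (trunk \<mu> r)"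
    using trunk_borel[OF tameD(3)[OF tame r]] sets_\<mu> by (intro emeasure_mono[OF sub]) simp
  then have fin: "emeasure \<mu> (up y) < \<infinity>" using tameD(4)[OF tame r] by (rule order.strict_trans1)
  have "ennreal h \<le> emeasure \<mu> (up y)" using y(1) by (simp add: R_eq)
  from ex_max_point_above[OF sets_\<mu> h_pos fin this]
  obtain z where z: "z \<in> max_points R" "y \<sqsubseteq> z" unfolding R_eq by blast
  then have "z \<in> trunk \<mu> r" using sub by auto
  then show ?thesis using z by (auto simp: ends_def)
qed

text \<open>Every direction of R at \<tau> contains an end: one above y if y is in the trunk,
  otherwise the cut point below y, which is strictly above \<tau> because \<tau> is in the trunk.
  Inside the trunk R thus branches like a finite antichain.\<close>

lemma dirs_R_eq:
  assumes \<tau>: "\<tau> \<in> trunk \<mu> r" "\<sigma> \<sqsubseteq> \<tau>" and r: "0 < r"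
  shows "dirs R \<tau> = dirs (ends r \<inter> up \<sigma>) \<tau>"
proof
  show "dirs (ends r \<inter> up \<sigma>) \<tau> \<subseteq> dirs R \<tau>"
    unfolding dirs_def using ends_subset_R by blast
  show "dirs R \<tau> \<subseteq> dirs (ends r \<inter> up \<sigma>) \<tau>"
  proof
    fix B assume "B \<in> dirs R \<tau>"
    then obtain y where y: "y \<in> R" "\<tau> \<sqsubset> y" "B = branch \<tau> y" unfolding dirs_def by blast
    obtain f where f: "f \<in> ends r" "\<tau> \<sqsubset> y \<sqinter> f"
    proof (cases "y \<in> trunk \<mu> r")
      case True
      then obtain f where f: "f \<in> ends r" "y \<sqsubseteq> f" using ex_end_above[OF y(1) _ r] by blast
      then have "y \<sqinter> f = y" using meet_eq_left by blast
      then show thesis using that[of f] f(1) y(2) by simp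
    next
      case False
      then obtain e where e: "e \<in> top_points \<mu> r" "e \<sqsubseteq> y" by (auto simp: trunk_def)
      have "\<not> e \<sqsubseteq> \<tau>" using \<tau>(1) e(1) by (auto simp: trunk_def)
      then have "\<tau> \<sqsubset> e" using le_below_cases[of \<tau> y e] y(2) e(2) by auto
      moreover have "y \<sqinter> e = e" using e(2) meet_eq_left meet_commute by metis
      ultimately show thesis using that[of e] e(1) by (simp add: ends_def)
    qed
    then have fb: "f \<in> branch \<tau> y" by (simp add: branch_def)
    then have "\<tau> \<sqsubset> f" using mem_branch_less by blast
    moreover have "\<sigma> \<sqsubseteq> f" using \<tau>(2) \<open>\<tau> \<sqsubset> f\<close> le_trans by blast
    ultimately show "B \<in> dirs (ends r \<inter> up \<sigma>) \<tau>"
      unfolding dirs_def using f(1) branch_eq[OF fb] y(3) by auto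
  qed
qed

text \<open>The antichain count applied to the ends above \<sigma>; the 1 stands on the left to
  avoid a subtraction.\<close>

lemma infsum_excess_trunk:
  assumes r: "0 < r" and \<sigma>: "\<sigma> \<in> R" "\<sigma> \<in> trunk \<mu> r"
  shows "(\<Sum>\<^sub>\<infinity>\<tau>\<in>R. excess R \<tau> * indicator (up \<sigma> \<inter> trunk \<mu> r) \<tau>) + 1 = of_nat (card (ends r \<inter> up \<sigma>))"
proof -
  define F where "F = ends r \<inter> up \<sigma>"
  define M where "M = (\<lambda>(f, g). f \<sqinter> g) ` (F \<times> F)"
  have F: "finite F" unfolding F_def using finite_ends[OF r] by simp
  have FR: "f \<in> R" "\<sigma> \<sqsubseteq> f" "f \<in> ends r" if "f \<in> F" for f
    using that ends_subset_R by (auto simp: F_def)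
  have F0: "F \<noteq> {}" using ex_end_above[OF \<sigma> r] by (auto simp: F_def)
  have M: "finite M" "\<And>x y. x \<in> F \<Longrightarrow> y \<in> F \<Longrightarrow> x \<sqinter> y \<in> M" unfolding M_def using F by auto
  \<comment> \<open>Two directions at \<tau> make it the meet of two ends. It is in the trunk, since
    a cut point below it would be an end strictly below another end.\<close>
  have forks: "\<tau> \<in> M \<and> \<tau> \<in> R \<and> \<tau> \<in> up \<sigma> \<inter> trunk \<mu> r" if "card (dirs F \<tau>) - 1 \<noteq> 0" for \<tau>
  proof -
    have "card (dirs F \<tau>) \<noteq> 0" "card (dirs F \<tau>) \<noteq> 1" using that by auto
    then obtain A B where AB: "A \<in> dirs F \<tau>" "B \<in> dirs F \<tau>" "A \<noteq> B"
      by (metis is_singletonI' is_singleton_altdef card.empty)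
    then obtain f g where fg: "f \<in> F" "\<tau> \<sqsubset> f" "A = branch \<tau> f" "g \<in> F" "\<tau> \<sqsubset> g" "B = branch \<tau> g"
      unfolding dirs_def by blast
    have "g \<notin> branch \<tau> f" using AB(3) fg branch_eq[of g \<tau> f] by auto
    moreover have "\<tau> \<sqsubseteq> f \<sqinter> g" using fg by (simp add: le_meet_iff)
    ultimately have t: "\<tau> = f \<sqinter> g" by (simp add: branch_def)
    have "\<tau> \<in> trunk \<mu> r"
    proof -
      have "\<not> e \<sqsubseteq> \<tau>" if e: "e \<in> top_points \<mu> r" for e
      proof
        assume "e \<sqsubseteq> \<tau>"
        then have "e \<sqsubseteq> f" using fg(2) le_trans by blast
        moreover have "e \<in> ends r" using e by (simp add: ends_def)
        ultimately have "e = f" using ends_antichain FR(3)[OF fg(1)] by blast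
        then show False using \<open>e \<sqsubseteq> \<tau>\<close> fg(2) le_antisym by blast
      qed
      then show ?thesis by (simp add: trunk_def)
    qed
    moreover have "\<sigma> \<sqsubseteq> \<tau>" unfolding t using FR(2) fg by (simp add: le_meet_iff)
    moreover have "\<tau> \<in> R" using R_down[OF FR(1)[OF fg(1)]] fg(2) by blast
    ultimately show ?thesis using M(2)[OF fg(1,4)] t by simp
  qed
  have "(\<Sum>\<^sub>\<infinity>\<tau>\<in>R. excess R \<tau> * indicator (up \<sigma> \<inter> trunk \<mu> r) \<tau>) = (\<Sum>\<tau>\<in>M. of_nat (card (dirs F \<tau>) - 1))"
  proof (rule infsum_ennreal_supported[OF M(1)])
    have exc: "excess R \<tau> = of_nat (card (dirs F \<tau>) - 1)" if "\<tau> \<in> up \<sigma> \<inter> trunk \<mu> r" for \<tau>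
    proof -
      have "dirs R \<tau> = dirs F \<tau>" unfolding F_def using dirs_R_eq[OF _ _ r] that by simp
      moreover have "finite (dirs F \<tau>)" unfolding dirs_def using F by simp
      ultimately show ?thesis by (simp add: excess_def)
    qed
    fix \<tau>
    have eq: "excess R \<tau> * indicator (up \<sigma> \<inter> trunk \<mu> r) \<tau> = of_nat (card (dirs F \<tau>) - 1)"
      if "\<tau> \<in> up \<sigma> \<inter> trunk \<mu> r \<or> card (dirs F \<tau>) - 1 = 0"
      using that exc[of \<tau>] by (cases "\<tau> \<in> up \<sigma> \<inter> trunk \<mu> r") auto
    show "excess R \<tau> * indicator (up \<sigma> \<inter> trunk \<mu> r) \<tau> = 0" if "\<tau> \<in> R - M"
      using that forks[of \<tau>] eq by fastforce
    show "of_nat (card (dirs F \<tau>) - 1) = (0 :: ennreal)" if "\<tau> \<in> M - R"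
      using that forks[of \<tau>] by fastforce
    show "excess R \<tau> * indicator (up \<sigma> \<inter> trunk \<mu> r) \<tau> = of_nat (card (dirs F \<tau>) - 1)" if "\<tau> \<in> M \<inter> R"
      using forks[of \<tau>] eq by blast
  qed
  also have "\<dots> + 1 = of_nat ((\<Sum>\<tau>\<in>M. card (dirs F \<tau>) - 1) + 1)"
    by (simp only: of_nat_add of_nat_sum of_nat_1)
  also have "(\<Sum>\<tau>\<in>M. card (dirs F \<tau>) - 1) + 1 = card F"
    by (rule card_antichain[OF F F0 M(1) _ M(2)]) (use ends_antichain FR(3) in blast)+
  finally show ?thesis unfolding F_def .
qed

section \<open>The erased mass of a cut up-set\<close>

lemma proj_mem_iff:
  assumes \<sigma>: "\<sigma> \<in> R"
  shows "tree_proj \<rho> R y \<in> up \<sigma> \<inter> trunk \<mu> r \<longleftrightarrow> y \<in> up \<sigma> \<inter> trunk \<mu> r"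
  using le_tree_proj_iff[OF rooted_subtree_R] \<sigma> top_points_subset_R
  unfolding trunk_def by (auto simp: subset_iff)

lemma proj_max_point_iff:
  assumes l: "l \<in> max_points R"
  shows "tree_proj \<rho> R y = l \<longleftrightarrow> l \<sqsubseteq> y"
proof -
  have "tree_proj \<rho> R y = l \<longleftrightarrow> l \<sqsubseteq> tree_proj \<rho> R y"
    using max_points_incomparable[OF l tree_proj_mem[OF rooted_subtree_R]] by auto
  also have "\<dots> \<longleftrightarrow> l \<sqsubseteq> y"
    using l by (intro le_tree_proj_iff[OF rooted_subtree_R]) (simp add: max_points_def)
  finally show ?thesis .
qed

text \<open>With l leaves and k cut points above \<sigma>, the leaves lose h l and the branching
  adds h (l + k - 1), a net gain of h (k - 1). The -h is moved to the left, where nothing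
  truncates.\<close>

lemma erasure_trunk_mass:
  assumes r: "0 < r" and \<sigma>: "\<sigma> \<in> R" "\<sigma> \<in> trunk \<mu> r"
  shows "emeasure (mass_erasure \<rho> h \<mu>) (up \<sigma> \<inter> trunk \<mu> r) + ennreal h =
    emeasure \<mu> (up \<sigma> \<inter> trunk \<mu> r) + ennreal h * of_nat (card (top_points \<mu> r \<inter> up \<sigma>))"
proof -
  define A where "A = up \<sigma> \<inter> trunk \<mu> r"
  define L where "L = max_points R \<inter> A"
  let ?K = "R - max_points R"
  let ?m = "\<lambda>l. emeasure \<mu> (up l)"
  have Ab: "A \<in> sets borel" unfolding A_def using trunk_borel[OF tameD(3)[OF tame r]] by auto
  have L: "finite L" unfolding L_def A_def
    using finite_max_points_trunk[OF r] by (rule finite_subset[rotated]) auto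
  have upL: "up l \<subseteq> A" if "l \<in> L" for l
    using that max_point_up_subset_trunk[of l r] up_mono[of \<sigma> l] by (auto simp: L_def A_def simp del: mem_up)
      (auto)
  define V where "V = tree_proj \<rho> R -` (A \<inter> ?K)"
  have Vs: "V \<in> sets \<mu>"
    using measurable_sets[OF tree_proj_measurable[OF rooted_subtree_R], of "A \<inter> ?K"] Ab core_borel sets_\<mu>
    by (auto simp: V_def)
  \<comment> \<open>\<sigma> and the cut points lie in R, so projecting to R does not move points
    into or out of A. Hence A splits according to whether the projected point is maximal.\<close>
  have split: "A = V \<union> (\<Union>l\<in>L. up l)"
  proof (intro set_eqI iffI)
    fix y assume y: "y \<in> A"
    then have pA: "tree_proj \<rho> R y \<in> A" unfolding A_def using proj_mem_iff[OF \<sigma>(1)] by blast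
    show "y \<in> V \<union> (\<Union>l\<in>L. up l)"
    proof (cases "tree_proj \<rho> R y \<in> max_points R")
      case True
      then have "tree_proj \<rho> R y \<in> L" using pA by (simp add: L_def)
      moreover have "y \<in> up (tree_proj \<rho> R y)" using proj_max_point_iff[OF True, of y] by simp
      ultimately show ?thesis by blast
    next
      case False
      then show ?thesis using pA tree_proj_mem[OF rooted_subtree_R] by (simp add: V_def)
    qed
  next
    fix y assume "y \<in> V \<union> (\<Union>l\<in>L. up l)"
    then show "y \<in> A"
    proof
      assume "y \<in> V"
      then have "tree_proj \<rho> R y \<in> A" by (simp add: V_def)
      then show "y \<in> A" unfolding A_def using proj_mem_iff[OF \<sigma>(1)] by blast
    qed (use upL in blast)
  qed
  have disj: "V \<inter> (\<Union>l\<in>L. up l) = {}"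
  proof -
    have False if "y \<in> V" "l \<in> L" "l \<sqsubseteq> y" for y l
      using that proj_max_point_iff[of l y] by (auto simp: V_def L_def)
    then show ?thesis by auto
  qed
  have "emeasure \<mu> (\<Union>l\<in>L. up l) = (\<Sum>l\<in>L. ?m l)"
    by (rule sum_emeasure[OF up_sets disjoint_family_on_mono[OF _ max_points_disjoint] L, symmetric])
      (simp add: L_def)
  moreover have "(\<Union>l\<in>L. up l) \<in> sets \<mu>"
    using up_sets by (intro sets.finite_UN[OF L]) auto
  ultimately have mass: "emeasure \<mu> A = emeasure \<mu> V + (\<Sum>l\<in>L. ?m l)"
    using plus_emeasure[OF Vs _ disj] unfolding split[symmetric] by simp
  have "infsum (\<lambda>l. (?m l - ennreal h) * indicator A l) (max_points R) = (\<Sum>l\<in>L. ?m l - ennreal h)"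
    by (rule infsum_ennreal_supported[OF L]) (auto simp: L_def)
  moreover have "(\<Sum>l\<in>L. ?m l - ennreal h) + ennreal h * of_nat (card L) = (\<Sum>l\<in>L. ?m l)"
  proof -
    have "(\<Sum>l\<in>L. ?m l - ennreal h) + (\<Sum>l\<in>L. ennreal h) = (\<Sum>l\<in>L. ?m l - ennreal h + ennreal h)"
      by (rule sum.distrib[symmetric])
    also have "\<dots> = (\<Sum>l\<in>L. ?m l)"
      by (rule sum.cong) (auto simp: L_def max_points_def R_eq intro: diff_add_cancel_ennreal)
    finally show ?thesis by (simp add: mult.commute)
  qed
  moreover have "emeasure (Pr \<rho> R \<mu>) (A \<inter> ?K) = emeasure \<mu> V"
    unfolding V_def using Ab core_borel by (intro Pr_emeasure[OF sets_\<mu> rooted_subtree_R]) auto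
  moreover define c where "c = (\<Sum>\<^sub>\<infinity>\<tau>\<in>R. excess R \<tau> * indicator A \<tau>)"
  moreover have c1: "c + 1 = of_nat (card L) + of_nat (card (top_points \<mu> r \<inter> up \<sigma>))"
  proof -
    have "ends r \<inter> up \<sigma> = L \<union> (top_points \<mu> r \<inter> up \<sigma>)" by (auto simp: ends_def L_def A_def)
    moreover have "L \<inter> (top_points \<mu> r \<inter> up \<sigma>) = {}" by (auto simp: L_def A_def trunk_def)
    ultimately have "card (ends r \<inter> up \<sigma>) = card L + card (top_points \<mu> r \<inter> up \<sigma>)"
      using L tameD(3)[OF tame r] by (simp add: card_Un_disjoint)
    then show ?thesis using infsum_excess_trunk[OF r \<sigma>] unfolding c_def A_def by simp
  qed
  ultimately obtain b where E: "erasure_fun h \<mu> A = emeasure \<mu> V + b + ennreal h * c"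
    and b: "b + ennreal h * of_nat (card L) = (\<Sum>l\<in>L. ?m l)"
    unfolding erasure_fun_def Let_def by metis
  let ?k = "of_nat (card (top_points \<mu> r \<inter> up \<sigma>)) :: ennreal"
  \<comment> \<open>The finite amount taken from the leaves is added to both sides and cancelled
    afterwards.\<close>
  have "ennreal h * of_nat (card L) + (erasure_fun h \<mu> A + ennreal h)
      = emeasure \<mu> V + (b + ennreal h * of_nat (card L)) + ennreal h * (c + 1)"
    unfolding E distrib_left by (simp add: add_ac)
  also have "\<dots> = ennreal h * of_nat (card L) + (emeasure \<mu> A + ennreal h * ?k)"
    unfolding b c1 mass distrib_left by (simp add: add_ac)
  finally have "erasure_fun h \<mu> A + ennreal h = emeasure \<mu> A + ennreal h * ?k"
    using ennreal_add_left_cancel by (simp add: ennreal_mult_eq_top_iff)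
  then show ?thesis using emeasure_mass_erasure[OF Ab] by (simp add: A_def)
qed

lemma erasure_off_level_set:
  assumes "\<sigma> \<notin> R"
  shows "emeasure (mass_erasure \<rho> h \<mu>) (up \<sigma>) = 0"
proof -
  have dis: "up \<sigma> \<inter> R = {}" using R_down assms by auto
  then have "up \<sigma> \<inter> (R - max_points R) = {}" by blast
  moreover have "(\<Sum>\<^sub>\<infinity>l\<in>max_points R. (emeasure \<mu> (up l) - ennreal h) * indicator (up \<sigma>) l) = 0"
    by (rule infsum_0) (use dis in \<open>auto simp: max_points_def indicator_def simp del: mem_up\<close>)
  moreover have "(\<Sum>\<^sub>\<infinity>\<tau>\<in>R. excess R \<tau> * indicator (up \<sigma>) \<tau>) = 0"
    by (rule infsum_0) (use dis in \<open>auto simp: indicator_def simp del: mem_up\<close>)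
  ultimately show ?thesis
    unfolding emeasure_mass_erasure[OF up_borel] erasure_fun_def Let_def by simp
qed

end

context rooted_real_tree
begin

section \<open>The semigroup property\<close>

lemma sets_mass_erasure_borel:
  assumes \<mu>: "tame \<mu>" and h: "0 \<le> h"
  shows "sets (mass_erasure \<rho> h \<mu>) = sets borel"
proof (cases "h = 0 \<or> emeasure \<mu> UNIV < ennreal h")
  case True
  then show ?thesis using tameD(1)[OF \<mu>] by (auto simp: mass_erasure_def)
next
  case False
  then interpret level_set \<rho> \<mu> h
    using \<mu> h by unfold_locales (auto simp: not_less)
  show ?thesis by (rule sets_mass_erasure)
qed

text \<open>For \<sigma> outside the level set there is no cut point above it and its mass is below
  h, so the truncated difference is 0, as is the erased mass.\<close>

lemma emeasure_mass_erasure_trunk: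
  assumes \<mu>: "tame \<mu>" and h: "0 \<le> h" and r: "0 < r" and \<sigma>: "\<sigma> \<in> trunk \<mu> r"
  shows "emeasure (mass_erasure \<rho> h \<mu>) (up \<sigma> \<inter> trunk \<mu> r) =
    emeasure \<mu> (up \<sigma> \<inter> trunk \<mu> r) + ennreal h * of_nat (card (top_points \<mu> r \<inter> up \<sigma>)) - ennreal h"
proof -
  note s = tameD(1)[OF \<mu>]
  have le: "emeasure \<mu> (up \<sigma> \<inter> trunk \<mu> r) \<le> emeasure \<mu> (up \<sigma>)"
    by (rule emeasure_mono) (use s up_borel in auto)
  have zero: "x - ennreal h = 0" if "x < ennreal h" for x
    by (rule diff_eq_0_ennreal) (use that order.strict_trans[OF that ennreal_less_top] in auto)
  consider "h = 0" | "0 < h" "emeasure \<mu> UNIV < ennreal h" | "0 < h" "ennreal h \<le> emeasure \<mu> UNIV"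
    using h by fastforce
  then show ?thesis
  proof cases
    case 1
    then show ?thesis by (simp add: mass_erasure_def)
  next
    case 2
    have lt: "emeasure \<mu> (up x) < ennreal h" for x
      using emeasure_up_antimono[OF s root_le, of x] 2(2) by simp
    then have "top_points \<mu> r = {}" by (auto simp: top_points_def)
        (metis ennreal_less_top less_asym)
    moreover have "emeasure \<mu> (up \<sigma> \<inter> trunk \<mu> r) - ennreal h = 0"
      by (rule zero[OF order.strict_trans1[OF le lt]])
    ultimately show ?thesis using 2 by (simp add: mass_erasure_def)
  next
    case 3
    interpret level_set \<rho> \<mu> h
      using \<mu> 3 by unfold_locales auto
    show ?thesis
    proof (cases "\<sigma> \<in> mass_level_set \<rho> \<mu> h")
      case True
      then show ?thesis using erasure_trunk_mass[OF r True \<sigma>, symmetric] by simp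
    next
      case False
      have "up \<sigma> \<inter> top_points \<mu> r = {}"
      proof -
        have "\<not> \<sigma> \<sqsubseteq> x" if "x \<in> top_points \<mu> r" for x
          using that False R_down[of x \<sigma>] top_points_subset_R by blast
        then show ?thesis by auto
      qed
      moreover have "emeasure \<mu> (up \<sigma> \<inter> trunk \<mu> r) - ennreal h = 0"
        using False by (intro zero order.strict_trans1[OF le]) (simp add: R_eq not_le)
      moreover have "emeasure (mass_erasure \<rho> h \<mu>) (up \<sigma> \<inter> trunk \<mu> r) \<le> emeasure (mass_erasure \<rho> h \<mu>) (up \<sigma>)"
        by (rule emeasure_mono) (use sets_mass_erasure up_borel in auto)
      ultimately show ?thesis using erasure_off_level_set[OF False] by (simp add: Int_commute)
    qed
  qed
qed

section \<open>Erasure of whole up-sets, and stability of the skeleton\<close>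

lemma trunk_exhausts: "\<exists>n. y \<in> trunk \<mu> (real (Suc n))"
proof -
  obtain n where "ht y < real n" using reals_Archimedean2 by blast
  then have "y \<in> trunk \<mu> (real (Suc n))" by (intro mem_trunk) simp
  then show ?thesis by blast
qed

text \<open>If the mass is finite, the up-set lies in a trunk without cut points above \<sigma>. If
  it is infinite, every cut has a point above \<sigma>, so erasure does not decrease the mass inside
  the trunk, and the trunks exhaust the up-set.\<close>

lemma emeasure_mass_erasure_up:
  assumes \<mu>: "tame \<mu>" and h: "0 \<le> h"
  shows "emeasure (mass_erasure \<rho> h \<mu>) (up \<sigma>) = emeasure \<mu> (up \<sigma>) - ennreal h"
proof (cases "emeasure \<mu> (up \<sigma>) < \<infinity>")
  case True
  note s = tameD(1)[OF \<mu>]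
  define r where "r = ht \<sigma> + 1"
  have r: "0 < r" unfolding r_def using zero_le_dist[of \<rho> \<sigma>] by linarith
  have \<sigma>: "\<sigma> \<in> trunk \<mu> r" by (intro mem_trunk) (simp add: r_def)
  have sub: "up \<sigma> \<inter> trunk \<mu> r = up \<sigma>"
    using finite_mass_up_subset_trunk[OF s \<sigma> True] by blast
  have "e \<notin> up \<sigma>" if "e \<in> top_points \<mu> r" for e
    using that emeasure_up_antimono[OF s, of \<sigma> e] True by (auto simp: top_points_def top_unique)
  then have "top_points \<mu> r \<inter> up \<sigma> = {}" by blast
  then show ?thesis using emeasure_mass_erasure_trunk[OF \<mu> h r \<sigma>] sub by simp
next
  case False
  then have inf: "emeasure \<mu> (up \<sigma>) = \<infinity>" by (simp add: less_top[symmetric])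
  note s = tameD(1)[OF \<mu>]
  let ?\<nu> = "mass_erasure \<rho> h \<mu>"
  obtain n0 where n0: "ht \<sigma> < real n0" using reals_Archimedean2 by blast
  define r where "r n = real (Suc (n0 + n))" for n
  have r: "0 < r n" "ht \<sigma> < r n" for n using n0 by (auto simp: r_def)
  have trb: "trunk \<mu> (r n) \<in> sets borel" for n by (rule trunk_borel[OF tameD(3)[OF \<mu> r(1)]])
  have low: "emeasure \<mu> (up \<sigma> \<inter> trunk \<mu> (r n)) \<le> emeasure ?\<nu> (up \<sigma>)" for n
  proof -
    define a where "a = emeasure \<mu> (up \<sigma> \<inter> trunk \<mu> (r n))"
    define K where "K = top_points \<mu> (r n) \<inter> up \<sigma>"
    have \<sigma>: "\<sigma> \<in> trunk \<mu> (r n)" using r(2) by (rule mem_trunk)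
    \<comment> \<open>Without a cut point above \<sigma> the whole up-set would lie in a trunk and
      have finite mass.\<close>
    have "K \<noteq> {}"
    proof
      assume "K = {}"
      then have "up \<sigma> \<subseteq> trunk \<mu> (r n)" unfolding K_def by (intro up_subset_trunk[OF \<sigma>]) auto
      then have "emeasure \<mu> (up \<sigma>) \<le> emeasure \<mu> (trunk \<mu> (r n))"
        using trb s by (intro emeasure_mono) auto
      then show False using inf tameD(4)[OF \<mu> r(1), of n] by (simp add: top_unique)
    qed
    moreover have "finite K" unfolding K_def using tameD(3)[OF \<mu> r(1)] by simp
    ultimately obtain j where j: "card K = Suc j" by (cases "card K") auto
    have "a + ennreal h * of_nat (card K) = a + ennreal h * of_nat j + ennreal h"
      unfolding j by (simp add: distrib_left add_ac)
    then have "a + ennreal h * of_nat (card K) - ennreal h = a + ennreal h * of_nat j"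
      by (simp only: ennreal_add_diff_cancel_right) simp
    then have "a \<le> emeasure ?\<nu> (up \<sigma> \<inter> trunk \<mu> (r n))"
      using emeasure_mass_erasure_trunk[OF \<mu> h r(1) \<sigma>] unfolding a_def K_def by simp
    also have "\<dots> \<le> emeasure ?\<nu> (up \<sigma>)"
      by (rule emeasure_mono) (use sets_mass_erasure_borel[OF \<mu> h] up_borel in auto)
    finally show ?thesis by (simp add: a_def)
  qed
  have "(SUP n. emeasure \<mu> (up \<sigma> \<inter> trunk \<mu> (r n))) = emeasure \<mu> (\<Union>n. up \<sigma> \<inter> trunk \<mu> (r n))"
  proof (rule SUP_emeasure_incseq)
    show "range (\<lambda>n. up \<sigma> \<inter> trunk \<mu> (r n)) \<subseteq> sets \<mu>" using s trb up_borel[of \<sigma>] by auto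
    have "trunk \<mu> (r n) \<subseteq> trunk \<mu> (r (Suc n))" for n
      by (rule trunk_mono[OF s]) (auto simp: r_def)
    then show "incseq (\<lambda>n. up \<sigma> \<inter> trunk \<mu> (r n))" by (intro incseq_SucI) blast
  qed
  moreover have "(\<Union>n. up \<sigma> \<inter> trunk \<mu> (r n)) = up \<sigma>"
  proof -
    have "\<exists>n. y \<in> trunk \<mu> (r n)" for y
    proof -
      obtain n where "y \<in> trunk \<mu> (real (Suc n))" using trunk_exhausts by blast
      moreover have "trunk \<mu> (real (Suc n)) \<subseteq> trunk \<mu> (r n)"
        by (rule trunk_mono[OF s]) (auto simp: r_def)
      ultimately show ?thesis by blast
    qed
    then show ?thesis by blast
  qed
  ultimately have "emeasure \<mu> (up \<sigma>) \<le> emeasure ?\<nu> (up \<sigma>)"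
    using low by (metis SUP_least)
  then show ?thesis using inf by (simp add: top_unique)
qed

lemma mass_erasure_infinite_iff:
  assumes "tame \<mu>" "0 \<le> h"
  shows "emeasure (mass_erasure \<rho> h \<mu>) (up \<sigma>) = \<infinity> \<longleftrightarrow> emeasure \<mu> (up \<sigma>) = \<infinity>"
  unfolding emeasure_mass_erasure_up[OF assms] by (simp add: ennreal_minus_eq_top)

lemma top_points_mass_erasure:
  "tame \<mu> \<Longrightarrow> 0 \<le> h \<Longrightarrow> top_points (mass_erasure \<rho> h \<mu>) r = top_points \<mu> r"
  unfolding top_points_def using mass_erasure_infinite_iff by blast

lemma trunk_mass_erasure:
  "tame \<mu> \<Longrightarrow> 0 \<le> h \<Longrightarrow> trunk (mass_erasure \<rho> h \<mu>) r = trunk \<mu> r"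
  unfolding trunk_def by (simp add: top_points_mass_erasure)

lemma tame_mass_erasure:
  assumes \<mu>: "tame \<mu>" and h: "0 \<le> h"
  shows "tame (mass_erasure \<rho> h \<mu>)"
proof -
  have "emeasure (mass_erasure \<rho> h \<mu>) (trunk \<mu> r) < \<infinity>" if r: "0 < r" for r
  proof -
    have "emeasure (mass_erasure \<rho> h \<mu>) (trunk \<mu> r) \<le>
        emeasure \<mu> (trunk \<mu> r) + ennreal h * of_nat (card (top_points \<mu> r))"
      using emeasure_mass_erasure_trunk[OF \<mu> h r mem_trunk[of \<rho>]] r by simp
    also have "\<dots> < \<infinity>"
      using tameD(4)[OF \<mu> r] by (simp add: ennreal_mult_less_top of_nat_less_top)
    finally show ?thesis .
  qed
  then show ?thesis
    unfolding tame_def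
    using sets_mass_erasure_borel[OF assms] top_points_mass_erasure[OF assms] trunk_mass_erasure[OF assms]
      mass_erasure_infinite_iff[OF assms] tameD(3,5)[OF \<mu>] by simp
qed

text \<open>Up-sets along the skeleton may all have infinite mass, so they are cut by trunks.
  Up-sets are nested or disjoint and trunks increase, which gives a generating system closed under
  intersections; cutting \<open>up \<rho>\<close> gives the exhausting sequence of finite
  mass.\<close>

lemma measure_eqI_trunk:
  assumes \<mu>: "tame \<mu>" and sets: "sets M = sets borel" "sets N = sets borel"
    and fin: "\<And>r. 0 < r \<Longrightarrow> emeasure M (trunk \<mu> r) < \<infinity>"
    and eq: "\<And>\<sigma> r. 0 < r \<Longrightarrow> \<sigma> \<in> trunk \<mu> r \<Longrightarrow>
      emeasure M (up \<sigma> \<inter> trunk \<mu> r) = emeasure N (up \<sigma> \<inter> trunk \<mu> r)"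
  shows "M = N"
proof -
  define t where "t n = trunk \<mu> (real (Suc n))" for n
  define G where "G = insert {} (range (\<lambda>(\<sigma>, n). up \<sigma> \<inter> t n))"
  have G: "up \<sigma> \<inter> t n \<in> G" for \<sigma> n unfolding G_def by blast
  have tmono: "t m \<subseteq> t n" if "m \<le> n" for m n
    unfolding t_def by (rule trunk_mono[OF tameD(1)[OF \<mu>]]) (use that in auto)
  have tUN: "(\<Union>n. t n) = UNIV" using trunk_exhausts[of _ \<mu>] by (auto simp: t_def)
  have tb: "t n \<in> sets borel" for n
    unfolding t_def by (rule trunk_borel[OF tameD(3)[OF \<mu>]]) simp
  have gen: "sets (borel :: 'a measure) = sigma_sets UNIV G"
  proof
    show "sigma_sets UNIV G \<subseteq> sets (borel :: 'a measure)"
    proof (rule sets.sigma_sets_subset[of G borel, simplified space_borel])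
      show "G \<subseteq> sets borel" unfolding G_def using tb up_borel by auto
    qed
    have "up \<sigma> \<in> sigma_sets UNIV G" for \<sigma>
    proof -
      have "up \<sigma> = (\<Union>n. up \<sigma> \<inter> t n)" using tUN by blast
      then show ?thesis using sigma_sets.Union[of "\<lambda>n. up \<sigma> \<inter> t n" UNIV G] sigma_sets.Basic[OF G] by simp
    qed
    then show "sets (borel :: 'a measure) \<subseteq> sigma_sets UNIV G"
      unfolding sets_borel_eq_sigma_up by (intro sigma_sets_mono) auto
  qed
  show ?thesis
  proof (rule measure_eqI_generator_eq[of G UNIV M N "\<lambda>n. up \<rho> \<inter> t n"])
    show "Int_stable G"
    proof (rule Int_stableI)
      fix A B assume "A \<in> G" "B \<in> G"
      then consider "A = {} \<or> B = {}" | \<sigma> m \<tau> n where "A = up \<sigma> \<inter> t m" "B = up \<tau> \<inter> t n"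
        unfolding G_def by auto
      then show "A \<inter> B \<in> G"
      proof cases
        case 1
        then show ?thesis by (auto simp: G_def)
      next
        case 2
        have t: "t m \<inter> t n = t (min m n)" using tmono[of m n] tmono[of n m] by (auto simp: min_def)
        have "up \<sigma> \<inter> up \<tau> = {} \<or> up \<sigma> \<inter> up \<tau> = up \<sigma> \<or> up \<sigma> \<inter> up \<tau> = up \<tau>"
          using up_disjoint_or_le[of \<sigma> \<tau>] up_mono[of \<sigma> \<tau>] up_mono[of \<tau> \<sigma>] by blast
        moreover have "A \<inter> B = (up \<sigma> \<inter> up \<tau>) \<inter> t (min m n)" using t 2 by blast
        ultimately have "A \<inter> B = {} \<or> A \<inter> B = up \<sigma> \<inter> t (min m n) \<or> A \<inter> B = up \<tau> \<inter> t (min m n)"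
          by (elim disjE) simp_all
        moreover have "{} \<in> G" by (simp add: G_def)
        ultimately show ?thesis using G by metis
      qed
    qed
    show "emeasure M X = emeasure N X" if "X \<in> G" for X
    proof -
      consider "X = {}" | \<sigma> n where "X = up \<sigma> \<inter> t n" using \<open>X \<in> G\<close> unfolding G_def by auto
      then show ?thesis
      proof cases
        case 2
        show ?thesis
        proof (cases "\<sigma> \<in> t n")
          case True
          then show ?thesis using eq[of "real (Suc n)" \<sigma>] unfolding 2 t_def by simp
        next
          case False
          then have "up \<sigma> \<inter> t n = {}" unfolding t_def using trunk_down by auto
          then show ?thesis unfolding 2 by simp
        qed
      qed simp
    qed
    show "emeasure M (up \<rho> \<inter> t n) \<noteq> \<infinity>" for n
      using fin[of "real (Suc n)"] by (simp add: t_def)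
    show "range (\<lambda>n. up \<rho> \<inter> t n) \<subseteq> G" using G by blast
    show "(\<Union>n. up \<rho> \<inter> t n) = UNIV" using tUN by simp
  qed (use sets gen in auto)
qed

lemma mass_erasure_mass_erasure:
  assumes \<mu>: "tame \<mu>" and h: "0 \<le> h" "0 \<le> h'"
  shows "mass_erasure \<rho> h (mass_erasure \<rho> h' \<mu>) = mass_erasure \<rho> (h + h') \<mu>"
proof (rule measure_eqI_trunk[OF \<mu>])
  let ?\<nu> = "mass_erasure \<rho> h' \<mu>"
  have \<nu>: "tame ?\<nu>" by (rule tame_mass_erasure[OF \<mu> h(2)])
  have hh: "0 \<le> h + h'" using h by simp
  show "sets (mass_erasure \<rho> h ?\<nu>) = sets borel" "sets (mass_erasure \<rho> (h + h') \<mu>) = sets borel"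
    by (rule sets_mass_erasure_borel[OF \<nu> h(1)], rule sets_mass_erasure_borel[OF \<mu> hh])
  show "emeasure (mass_erasure \<rho> h ?\<nu>) (trunk \<mu> r) < \<infinity>" if "0 < r" for r
    using tameD(4)[OF tame_mass_erasure[OF \<nu> h(1)] that]
    by (simp add: trunk_mass_erasure[OF \<nu> h(1)] trunk_mass_erasure[OF \<mu> h(2)])
  fix \<sigma> r assume r: "0 < r" and \<sigma>: "\<sigma> \<in> trunk \<mu> r"
  define a where "a = emeasure \<mu> (up \<sigma> \<inter> trunk \<mu> r)"
  define k where "k = card (top_points \<mu> r \<inter> up \<sigma>)"
  have L: "emeasure (mass_erasure \<rho> h ?\<nu>) (up \<sigma> \<inter> trunk \<mu> r) =
      (a + ennreal h' * of_nat k - ennreal h') + ennreal h * of_nat k - ennreal h"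
    using emeasure_mass_erasure_trunk[OF \<nu> h(1) r, of \<sigma>] emeasure_mass_erasure_trunk[OF \<mu> h(2) r \<sigma>] \<sigma>
    by (simp add: trunk_mass_erasure[OF \<mu> h(2)] top_points_mass_erasure[OF \<mu> h(2)] a_def k_def)
  have R: "emeasure (mass_erasure \<rho> (h + h') \<mu>) (up \<sigma> \<inter> trunk \<mu> r) =
      a + (ennreal h + ennreal h') * of_nat k - (ennreal h + ennreal h')"
    using emeasure_mass_erasure_trunk[OF \<mu> hh r \<sigma>] h by (simp add: a_def k_def)
  have "emeasure \<mu> (up \<sigma> \<inter> trunk \<mu> r) \<le> emeasure \<mu> (trunk \<mu> r)"
    using trunk_borel[OF tameD(3)[OF \<mu> r]] tameD(1)[OF \<mu>] by (intro emeasure_mono) auto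
  then have "a < \<infinity>" unfolding a_def using tameD(4)[OF \<mu> r] by (rule order.strict_trans1)
  then obtain b where b: "a = ennreal b" "0 \<le> b" by (cases a) auto
  show "emeasure (mass_erasure \<rho> h ?\<nu>) (up \<sigma> \<inter> trunk \<mu> r) =
      emeasure (mass_erasure \<rho> (h + h') \<mu>) (up \<sigma> \<inter> trunk \<mu> r)"
  \<comment> \<open>Without cut points the subtractions may truncate, and a is finite, so truncated
    real subtractions are composed. With j + 1 cut points, each erasure just adds its level times
    j.\<close>
  proof (cases k)
    case 0
    then show ?thesis
      unfolding L R b(1) using h b(2) by (simp add: ennreal_minus ennreal_plus[symmetric] diff_diff_eq add.commute
          del: ennreal_plus)
  next
    case (Suc j)
    have c: "x + ennreal u * of_nat k - ennreal u = x + ennreal u * of_nat j" for x u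
    proof -
      have "x + ennreal u * of_nat k = x + ennreal u * of_nat j + ennreal u"
        unfolding Suc by (simp add: distrib_left add_ac)
      then show ?thesis by (simp only: ennreal_add_diff_cancel_right) simp
    qed
    have hsum: "ennreal h + ennreal h' = ennreal (h + h')" using h by simp
    show ?thesis unfolding L R hsum c
      unfolding hsum[symmetric] distrib_right by (simp add: add_ac)
  qed
qed

section \<open>Finite and discretely infinite measures are tame\<close>

lemma tame_finite:
  assumes "\<mu> \<in> finite_borel_measures"
  shows "tame \<mu>"
proof -
  have s: "sets \<mu> = sets borel" and fin: "emeasure \<mu> UNIV < \<infinity>"
    using assms by (auto simp: finite_borel_measures_def)
  have lt: "emeasure \<mu> (up x) < \<infinity>" for x
    using emeasure_up_antimono[OF s root_le, of x] fin by (simp add: order.strict_trans1)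
  then have ne: "emeasure \<mu> (up x) \<noteq> \<infinity>" for x by (metis less_irrefl)
  then have e: "top_points \<mu> r = {}" for r unfolding top_points_def by blast
  then have "trunk \<mu> r = UNIV" for r by (simp add: trunk_def)
  \<comment> \<open>The last clause of \<open>tame\<close> holds because the root lies strictly
    below every other y and has finite mass.\<close>
  then show ?thesis
    unfolding tame_def e using s fin ne[of \<rho>] root_le by (metis finite.emptyI)
qed

lemma rooted_subtree_Skel:
  assumes s: "sets \<mu> = sets borel" and c: "complete (Skel \<rho> \<mu>)"
  shows "rooted_subtree (Skel \<rho> \<mu>)"
  unfolding rooted_subtree_def
proof (intro conjI ballI allI impI)
  show "\<rho> \<in> Skel \<rho> \<mu>" by (simp add: Skel_def)
next
  fix x w assume "x \<in> Skel \<rho> \<mu>" "w \<sqsubseteq> x"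
  then show "w \<in> Skel \<rho> \<mu>"
    using emeasure_up_antimono[OF s, of w x] le_root[of w] by (auto simp: Skel_def top_unique)
next
  fix y assume below: "\<forall>x. x \<sqsubset> y \<longrightarrow> x \<in> Skel \<rho> \<mu>"
  show "y \<in> Skel \<rho> \<mu>"
  proof (cases "y = \<rho>")
    case False
    then have "0 < ht y" by simp
    have "y \<in> closure (Skel \<rho> \<mu>)"
      unfolding closure_approachable
    proof (intro allI impI)
      fix e :: real assume "0 < e"
      define t where "t = max 0 (ht y - e / 2)"
      have t: "0 \<le> t" "t < ht y" "ht y - e < t" using \<open>0 < e\<close> \<open>0 < ht y\<close> by (auto simp: t_def)
      have hp: "ht (pt y t) = t" and le: "pt y t \<sqsubseteq> y" using t ht_pt pt_le by auto
      have "pt y t \<noteq> y" using hp t by auto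
      then have "pt y t \<in> Skel \<rho> \<mu>" using below le by blast
      moreover have "dist (pt y t) y < e" using dist_le[OF le] hp t by simp
      ultimately show "\<exists>x\<in>Skel \<rho> \<mu>. dist x y < e" by blast
    qed
    then show ?thesis using complete_imp_closed[OF c] by (simp add: closure_closed)
  qed (simp add: Skel_def)
qed

text \<open>Points of a sphere form an antichain, so their number is bounded through the branching
  below them, which discreteness makes finite.\<close>

lemma finite_discrete_tree_sphere:
  assumes D: "rooted_subtree D" and disc: "discrete_real_tree D \<rho>" and r: "0 < r"
  shows "finite (D \<inter> sphere \<rho> r)"
proof (rule ccontr)
  assume inf: "infinite (D \<inter> sphere \<rho> r)"
  define B where "B = branch_points \<rho> D \<inter> cball \<rho> r"
  have sum: "ennreal_of_enat (degree \<rho> D) + (\<Sum>\<^sub>\<infinity>\<sigma>\<in>B. ennreal_of_enat (degree \<sigma> D)) < \<infinity>"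
    using disc r unfolding discrete_real_tree_def B_def by blast
  then have sum': "(\<Sum>\<^sub>\<infinity>\<sigma>\<in>B. ennreal_of_enat (degree \<sigma> D)) < \<infinity>" and deg\<rho>': "ennreal_of_enat (degree \<rho> D) < \<infinity>"
    by auto
  have deg\<rho>: "degree \<rho> D \<noteq> \<infinity>"
  proof
    assume "degree \<rho> D = \<infinity>"
    then show False using deg\<rho>' by simp
  qed
  have BD: "\<sigma> \<in> D" "\<sigma> \<noteq> \<rho>" "3 \<le> degree \<sigma> D" if "\<sigma> \<in> B" for \<sigma>
    using that by (auto simp: B_def branch_points_def)
  have finB: "finite B"
  proof (rule finite_if_infsum_finite[OF sum'])
    fix \<sigma> assume "\<sigma> \<in> B"
    then have "1 \<le> degree \<sigma> D" by (intro order_trans[OF one_le_numeral BD(3)])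
    then show "1 \<le> ennreal_of_enat (degree \<sigma> D)"
      using ennreal_of_enat_le_iff[of 1 "degree \<sigma> D"] by simp
  qed
  have degB: "degree \<sigma> D \<noteq> \<infinity>" if "\<sigma> \<in> B" for \<sigma>
  proof -
    have "ennreal_of_enat (degree \<sigma> D) \<le> (\<Sum>\<^sub>\<infinity>\<sigma>\<in>B. ennreal_of_enat (degree \<sigma> D))"
      using sum_le_infsum_ennreal[of "{\<sigma>}" B "\<lambda>\<sigma>. ennreal_of_enat (degree \<sigma> D)"] that by simp
    then have "ennreal_of_enat (degree \<sigma> D) < \<infinity>" using sum' by (rule order.strict_trans1)
    then show ?thesis by (metis ennreal_of_enat_infty less_irrefl)
  qed
  define G where "G = insert \<rho> B"
  have findirs: "finite (dirs D \<tau>)" if "\<tau> \<in> G" for \<tau>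
    using that degree_rooted_subtree[OF D, of \<tau>] degB[of \<tau>] deg\<rho> BD(1)[of \<tau>] rooted_subtreeD(1)[OF D]
    unfolding G_def by (auto split: if_splits)
  \<comment> \<open>The antichain count bounds the size of any finite F in the sphere by K, so a
    subset of size K + 1 is contradictory.\<close>
  define K where "K = (\<Sum>\<tau>\<in>G. card (dirs D \<tau>)) + 1"
  obtain F where F: "F \<subseteq> D \<inter> sphere \<rho> r" "finite F" "card F = Suc K"
    using infinite_arbitrarily_large[OF inf] by metis
  define M where "M = (\<lambda>(f, g). f \<sqinter> g) ` (F \<times> F)"
  have M: "finite M" unfolding M_def using F(2) by simp
  \<comment> \<open>Two directions towards F and the component of the root give degree at least 3,
    so every fork other than the root is a branch point in the ball.\<close>
  have off: "card (dirs F \<tau>) - 1 = 0" if "\<tau> \<notin> G" for \<tau>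
  proof (rule ccontr)
    assume c: "card (dirs F \<tau>) - 1 \<noteq> 0"
    then have "dirs F \<tau> \<noteq> {}" by auto
    then obtain f where f: "f \<in> F" "\<tau> \<sqsubset> f" unfolding dirs_def by blast
    have \<tau>: "\<tau> \<in> D" using rooted_subtreeD(2)[OF D, of f \<tau>] f F(1) by blast
    have "ht \<tau> \<le> r" using le_ht[of \<tau> f] f F(1) by auto
    moreover have "\<tau> \<noteq> \<rho>" using that by (simp add: G_def)
    moreover have "3 \<le> degree \<tau> D"
    proof (cases "finite (dirs D \<tau>)")
      case True
      have "dirs F \<tau> \<subseteq> dirs D \<tau>" unfolding dirs_def using F(1) by blast
      then have "card (dirs F \<tau>) \<le> card (dirs D \<tau>)" by (rule card_mono[OF True])
      then show ?thesis
        using degree_rooted_subtree[OF D \<tau>] True \<open>\<tau> \<noteq> \<rho>\<close> c by (simp add: numeral_eq_enat)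
    next
      case False
      then show ?thesis using degree_rooted_subtree[OF D \<tau>] by simp
    qed
    ultimately have "\<tau> \<in> B" using \<tau> by (simp add: B_def branch_points_def)
    then show False using that by (simp add: G_def)
  qed
  have "Suc K = (\<Sum>\<tau>\<in>M. card (dirs F \<tau>) - 1) + 1"
  proof -
    have "(\<Sum>\<tau>\<in>M. card (dirs F \<tau>) - 1) + 1 = card F"
    proof (rule card_antichain[OF F(2) _ M])
      show "F \<noteq> {}" using F(3) by auto
      show "x = y" if "x \<in> F" "y \<in> F" "x \<sqsubseteq> y" for x y
      proof -
        have "x \<in> sphere \<rho> r" "y \<in> sphere \<rho> r" using that F(1) by blast+
        then show ?thesis using le_eq_ht[OF that(3)] by simp
      qed
      show "x \<sqinter> y \<in> M" if "x \<in> F" "y \<in> F" for x y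
        using that unfolding M_def by auto
    qed
    then show ?thesis using F(3) by simp
  qed
  also have "(\<Sum>\<tau>\<in>M. card (dirs F \<tau>) - 1) = (\<Sum>\<tau>\<in>M \<inter> G. card (dirs F \<tau>) - 1)"
    using off M by (intro sum.mono_neutral_right) auto
  also have "\<dots> \<le> (\<Sum>\<tau>\<in>M \<inter> G. card (dirs D \<tau>))"
  proof (rule sum_mono)
    fix \<tau> assume "\<tau> \<in> M \<inter> G"
    moreover have "dirs F \<tau> \<subseteq> dirs D \<tau>" unfolding dirs_def using F(1) by blast
    ultimately have "card (dirs F \<tau>) \<le> card (dirs D \<tau>)" using findirs by (intro card_mono) auto
    then show "card (dirs F \<tau>) - 1 \<le> card (dirs D \<tau>)" by simp
  qed
  also have "\<dots> \<le> (\<Sum>\<tau>\<in>G. card (dirs D \<tau>))"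
    using finB by (intro sum_mono2) (auto simp: G_def)
  finally show False by (simp add: K_def)
qed

text \<open>Each point of height at least r has one ancestor at height r, and the point is in the
  trunk exactly when that ancestor is off the skeleton.\<close>

lemma fringe_eq:
  assumes r: "0 < r"
  shows "(\<Union>\<sigma>\<in>sphere \<rho> r \<inter> - Skel \<rho> \<mu>. up \<sigma>) = {y\<in>trunk \<mu> r. r \<le> ht y}"
proof (intro set_eqI iffI)
  fix y assume "y \<in> (\<Union>\<sigma>\<in>sphere \<rho> r \<inter> - Skel \<rho> \<mu>. up \<sigma>)"
  then obtain \<sigma> where \<sigma>: "ht \<sigma> = r" "\<sigma> \<notin> Skel \<rho> \<mu>" "\<sigma> \<sqsubseteq> y" by auto
  have "\<not> e \<sqsubseteq> y" if e: "e \<in> top_points \<mu> r" for e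
  proof
    assume "e \<sqsubseteq> y"
    then have "e \<sqsubseteq> \<sigma>" using le_below_linear[OF _ \<sigma>(3)] e \<sigma>(1) by (simp add: top_points_def)
    then have "e = \<sigma>" using le_eq_ht e \<sigma>(1) by (simp add: top_points_def)
    then show False using e \<sigma>(2) by (simp add: top_points_def Skel_def)
  qed
  then show "y \<in> {y\<in>trunk \<mu> r. r \<le> ht y}" using le_ht[OF \<sigma>(3)] \<sigma>(1) by (simp add: trunk_def)
next
  fix y assume "y \<in> {y\<in>trunk \<mu> r. r \<le> ht y}"
  then have y: "y \<in> trunk \<mu> r" "r \<le> ht y" by auto
  have p: "pt y r \<sqsubseteq> y" "ht (pt y r) = r" using y r pt_le ht_pt by auto
  have "pt y r \<notin> Skel \<rho> \<mu>"
    using y(1) p r by (auto simp: trunk_def top_points_def Skel_def)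
  then show "y \<in> (\<Union>\<sigma>\<in>sphere \<rho> r \<inter> - Skel \<rho> \<mu>. up \<sigma>)" using p by auto
qed

text \<open>The trunk is covered by a ball and the subtrees hanging off the skeleton at height r:
  bounded finiteness controls the first, the last condition of \<open>discretely_infinite\<close>
  the second.\<close>

lemma tame_discretely_infinite:
  assumes bf: "\<mu> \<in> boundedly_finite_measures" and di: "discretely_infinite \<rho> \<mu>"
  shows "tame \<mu>"
proof -
  have s: "sets \<mu> = sets borel" using bf by (simp add: boundedly_finite_measures_def)
  have disc: "discrete_real_tree (Skel \<rho> \<mu>) \<rho>" using di by (simp add: discretely_infinite_def)
  have S: "rooted_subtree (Skel \<rho> \<mu>)"
    by (rule rooted_subtree_Skel[OF s]) (use disc in \<open>simp add: discrete_real_tree_def\<close>)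
  have top: "finite (top_points \<mu> r)" if r: "0 < r" for r
    by (rule finite_subset[OF _ finite_discrete_tree_sphere[OF S disc r]])
      (auto simp: top_points_def Skel_def)
  have trunk: "emeasure \<mu> (trunk \<mu> r) < \<infinity>" if r: "0 < r" for r
  proof -
    have cb: "emeasure \<mu> (cball \<rho> r) < \<infinity>" "cball \<rho> r \<in> sets \<mu>"
      using bf s by (auto simp: boundedly_finite_measures_def)
    have fr: "emeasure \<mu> {y\<in>trunk \<mu> r. r \<le> ht y} < \<infinity>"
      using di r unfolding discretely_infinite_def fringe_eq[OF r, symmetric] by blast
    have "closed {y. r \<le> ht y}" by (intro closed_Collect_le continuous_intros)
    then have "trunk \<mu> r \<inter> {y. r \<le> ht y} \<in> sets borel"
      by (intro sets.Int[OF trunk_borel[OF top[OF r]]] borel_closed)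
    then have frs: "{y\<in>trunk \<mu> r. r \<le> ht y} \<in> sets \<mu>" using s by (simp add: Int_def)
    have "emeasure \<mu> (trunk \<mu> r) \<le> emeasure \<mu> (cball \<rho> r \<union> {y\<in>trunk \<mu> r. r \<le> ht y})"
      using cb(2) frs by (intro emeasure_mono) auto
    also have "\<dots> \<le> emeasure \<mu> (cball \<rho> r) + emeasure \<mu> {y\<in>trunk \<mu> r. r \<le> ht y}"
      by (rule emeasure_subadditive[OF cb(2) frs])
    also have "\<dots> < \<infinity>" using cb(1) fr by simp
    finally show ?thesis .
  qed
  have "emeasure \<mu> (up y) = \<infinity>" if "y \<noteq> \<rho>" "\<forall>x. x \<sqsubset> y \<longrightarrow> emeasure \<mu> (up x) = \<infinity>" for y
  proof -
    have "y \<in> Skel \<rho> \<mu>" by (rule rooted_subtreeD(3)[OF S]) (use that(2) in \<open>simp add: Skel_def\<close>)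
    then show ?thesis using that(1) by (simp add: Skel_def)
  qed
  then show ?thesis unfolding tame_def using s top trunk by blast
qed

lemma tame_di_measures: "\<mu> \<in> di_measures \<rho> \<Longrightarrow> tame \<mu>"
  unfolding di_measures_def using tame_finite tame_discretely_infinite by blast

text \<open>The skeleton is unchanged, so its discreteness is inherited. Bounded sets and the
  subtrees off the skeleton lie in trunks, which keep finite mass.\<close>

lemma mass_erasure_di_measures:
  assumes di: "\<mu> \<in> di_measures \<rho>" and h: "0 \<le> h"
  shows "mass_erasure \<rho> h \<mu> \<in> di_measures \<rho>"
proof -
  let ?\<nu> = "mass_erasure \<rho> h \<mu>"
  have \<mu>: "tame \<mu>" by (rule tame_di_measures[OF di])
  have \<nu>: "tame ?\<nu>" by (rule tame_mass_erasure[OF \<mu> h])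
  have s: "sets ?\<nu> = sets borel" by (rule tameD(1)[OF \<nu>])
  have total: "emeasure ?\<nu> UNIV = emeasure \<mu> UNIV - ennreal h"
    using emeasure_mass_erasure_up[OF \<mu> h, of \<rho>] by simp
  show ?thesis
  proof (cases "\<mu> \<in> finite_borel_measures")
    case True
    then have "emeasure ?\<nu> UNIV < \<infinity>"
      unfolding total finite_borel_measures_def using diff_le_self_ennreal order.strict_trans1 by blast
    then show ?thesis using s by (simp add: di_measures_def finite_borel_measures_def)
  next
    case False
    then have bf: "\<mu> \<in> boundedly_finite_measures" and inf: "discretely_infinite \<rho> \<mu>"
      using di by (auto simp: di_measures_def)
    have Skel: "Skel \<rho> ?\<nu> = Skel \<rho> \<mu>"
      unfolding Skel_def using mass_erasure_infinite_iff[OF \<mu> h] by simp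
    have small: "emeasure ?\<nu> A < \<infinity>" if "A \<subseteq> trunk ?\<nu> r" "0 < r" for A r
    proof -
      have "emeasure ?\<nu> A \<le> emeasure ?\<nu> (trunk ?\<nu> r)"
        using trunk_borel[OF tameD(3)[OF \<nu> that(2)]] s by (intro emeasure_mono[OF that(1)]) simp
      then show ?thesis using tameD(4)[OF \<nu> that(2)] by (rule order.strict_trans1)
    qed
    have "emeasure ?\<nu> A < \<infinity>" if "bounded A" for A
    proof -
      obtain e where e: "\<And>y. y \<in> A \<Longrightarrow> ht y \<le> e"
        using \<open>bounded A\<close> unfolding bounded_any_center[of A \<rho>] by blast
      have "A \<subseteq> trunk ?\<nu> (max e 0 + 1)"
      proof
        fix y assume "y \<in> A"
        then show "y \<in> trunk ?\<nu> (max e 0 + 1)" using e[of y] by (intro mem_trunk) simp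
      qed
      then show ?thesis by (rule small) simp
    qed
    then have "?\<nu> \<in> boundedly_finite_measures" using s by (simp add: boundedly_finite_measures_def)
    moreover have "emeasure ?\<nu> (\<Union>\<sigma>\<in>sphere \<rho> r \<inter> - Skel \<rho> ?\<nu>. up \<sigma>) < \<infinity>" if "0 < r" for r
      unfolding fringe_eq[OF that] by (rule small[OF _ that]) auto
    moreover have "emeasure ?\<nu> UNIV = \<infinity>"
      using inf unfolding total discretely_infinite_def by simp
    moreover have "discrete_real_tree (Skel \<rho> ?\<nu>) \<rho>"
      using inf unfolding discretely_infinite_def Skel by blast
    ultimately show ?thesis
      unfolding di_measures_def discretely_infinite_def by blast
  qed
qed

end

theorem proposition2p9:
  fixes \<rho> :: "'a::polish_space"
  assumes "real_tree (UNIV :: 'a set) \<rho>"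
  shows "(\<forall>h\<ge>0. \<forall>\<mu>\<in>di_measures \<rho>. mass_erasure \<rho> h \<mu> \<in> di_measures \<rho>) \<and>
         (\<forall>h\<ge>0. \<forall>h'\<ge>0. \<forall>\<mu>\<in>di_measures \<rho>.
            mass_erasure \<rho> h (mass_erasure \<rho> h' \<mu>) = mass_erasure \<rho> (h + h') \<mu>)"
proof -
  interpret rooted_real_tree \<rho> by unfold_locales (rule assms)
  show ?thesis
    using mass_erasure_di_measures mass_erasure_mass_erasure tame_di_measures by blast
qed

end
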